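(* Let $X=(X,d)$ be a complete separable metric space, let $a<b$ be real numbers, and let $p\in(1,\infty)$. A map $\gamma:[a,b]\to X$ is Borel with the equivalence class $[\gamma]$ in $W^1_p([a,b],X)$ if and only if, for every Lipschitz function $h:X\to\mathbb{R}$, the function $h\circ\gamma$ is Borel and $[h\circ\gamma]\in W^1_p([a,b],\mathbb{R})$.
   Context: For a metric space $(Y,\rho)$ and a Borel map $f:[a,b]\to Y$, $[f]$ denotes the equivalence class of $f$ up to $\mathcal{L}^1$-a.e. equality on $[a,b]$ ($\mathcal{L}^1$ is Lebesgue measure). For $p\in[1,\infty)$, $\widetilde L_p([a,b])$ is the space of Borel functions $f:[a,b]\to\mathbb{R}$ with $\int_a^b|f(t)|^p\,dt<+\infty$; $\widetilde L_p([a,b],Y)$ is the set of Borel maps $f:[a,b]\to Y$ such that $\rho(\underline y,f(\cdot))\in\widetilde L_p([a,b])$ for some (equivalently every) $\underline y\in Y$; and $L_p([a,b],Y):=\{[f]:f\in\widetilde L_p([a,b],Y)\}$. Let $(Y,\rho)$ be a complete separable metric space and $p\in(1,\infty)$. The equivalence class $[\gamma]$ of a Borel map $\gamma:[a,b]\to Y$ belongs to the Sobolev space $W^1_p([a,b],Y)$ if $[\gamma]\in L_p([a,b],Y)$ and there exist a nonnegative function $G\in\widetilde L_p([a,b])$ and a Borel set $E\subset[a,b]$ with $\mathcal{L}^1([a,b]\setminus E)=0$ such that $\rho(\gamma(t_1),\gamma(t_2))\le\int_{t_1}^{t_2}G(t)\,dt$ for all $t_1,t_2\in E$ with $t_1\le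 t_2$. For $Y=\mathbb{R}$ this is naturally identified with the classical Sobolev space on $(a,b)$. *)

theory Defs
  imports "HOL-Analysis.Analysis"
begin

text \<open>
  A map on \<open>[a,b]\<close> is a total function on \<^typ>\<open>real\<close> of which only the values on
  \<^term>\<open>{a..b}\<close> matter. The measure space is \<open>[a,b]\<close> with its Borel sigma-algebra and the
  restriction of Lebesgue measure, so \<^term>\<open>borel_measurable (interval_measure_space a b)\<close> is
  the set of maps that are Borel on \<open>[a,b]\<close>.
\<close>

definition interval_measure_space :: "real \<Rightarrow> real \<Rightarrow> real measure" where
  "interval_measure_space a b = restrict_space lborel {a..b}"

abbreviation borel_map_on :: "real \<Rightarrow> real \<Rightarrow> (real \<Rightarrow> 'a::topological_space) \<Rightarrow> bool" where
  "borel_map_on a b f \<equiv> f \<in> borel_measurable (interval_measure_space a b)"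

definition ae_class ::
    "real \<Rightarrow> real \<Rightarrow> (real \<Rightarrow> 'a::metric_space) \<Rightarrow> (real \<Rightarrow> 'a) set" where
  "ae_class a b f =
    {g. borel_map_on a b g \<and> (AE t in interval_measure_space a b. g t = f t)}"

definition Lp_fun :: "real \<Rightarrow> real \<Rightarrow> real \<Rightarrow> (real \<Rightarrow> real) set" where
  "Lp_fun p a b =
    {f. borel_map_on a b f \<and>
        (\<integral>\<^sup>+ t. ennreal (\<bar>f t\<bar> powr p) \<partial>interval_measure_space a b) < \<infinity>}"

definition Lp_map :: "real \<Rightarrow> real \<Rightarrow> real \<Rightarrow> (real \<Rightarrow> 'a::metric_space) set" where
  "Lp_map p a b = {f. borel_map_on a b f \<and> (\<exists>y. (\<lambda>t. dist y (f t)) \<in> Lp_fun p a b)}"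

definition Lp_space :: "real \<Rightarrow> real \<Rightarrow> real \<Rightarrow> (real \<Rightarrow> 'a::metric_space) set set" where
  "Lp_space p a b = {ae_class a b f | f. f \<in> Lp_map p a b}"

text \<open>
  Complete separable metric spaces are rendered by the class \<^class>\<open>polish_space\<close>, which
  consists of the complete metric spaces with second countable topology.
\<close>

definition W1p :: "real \<Rightarrow> real \<Rightarrow> real \<Rightarrow> (real \<Rightarrow> 'a::polish_space) set set" where
  "W1p p a b =
    {ae_class a b \<gamma> | \<gamma>. borel_map_on a b \<gamma> \<and> ae_class a b \<gamma> \<in> Lp_space p a b \<and>
      (\<exists>G E. G \<in> Lp_fun p a b \<and> (\<forall>t\<in>{a..b}. 0 \<le> G t) \<and>
         E \<in> sets borel \<and> E \<subseteq> {a..b} \<and> emeasure lborel ({a..b} - E) = 0 \<and>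
         (\<forall>t1\<in>E. \<forall>t2\<in>E. t1 \<le> t2 \<longrightarrow>
            dist (\<gamma> t1) (\<gamma> t2) \<le> (LINT t:{t1..t2}|lborel. G t)))}"

end

theory Submission
  imports Defs
begin

text \<open>
  If \<open>\<gamma>\<close> is a Sobolev curve and \<open>h\<close> is \<open>C\<close>-Lipschitz, then \<open>C\<close> times a function that dominates
  the increments of \<open>\<gamma>\<close> dominates those of \<open>h \<circ> \<gamma>\<close>. The converse has to produce a single
  function in \<open>L\<^sub>p\<close> from the separate ones that belong to the compositions \<open>h \<circ> \<gamma>\<close>.

  Let \<open>x\<^sub>n\<close> be a dense sequence and \<open>f\<^sub>n = dist x\<^sub>n \<circ> \<gamma>\<close>. Since \<open>dist (\<gamma> s) (\<gamma> t)\<close> is the supremum of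
  \<open>\<bar>f\<^sub>n s - f\<^sub>n t\<bar>\<close>, the natural candidate is \<open>G = sup\<^sub>n \<bar>f\<^sub>n'\<bar>\<close>, and the whole problem is to bound
  its \<open>L\<^sub>p\<close> norm. Two facts give the bound.

  The first is a uniform boundedness principle. The \<open>L\<^sub>p\<close> norm of \<open>(h \<circ> \<gamma>)'\<close> is a supremum of
  seminorms of \<open>h\<close> that see only finitely many increments of \<open>h \<circ> \<gamma>\<close>, each of them continuous for
  the Lipschitz norm. Finiteness for every Lipschitz \<open>h\<close> therefore gives one bound \<open>C\<close> for
  all \<open>1\<close>-Lipschitz \<open>h\<close>; this is a gliding hump
  (\<open>weighted_variation_uniform_bound\<close>). The principle is used twice: for single increments it shows that
  \<open>\<gamma>\<close> is Hoelder continuous on a set of full measure and so has a continuous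
  representative, and for equidistant partitions it bounds the derivatives
  (\<open>uniform_derivative_bound\<close>).

  The second is that the maximum of \<open>\<bar>f\<^sub>0'\<bar>, \<dots>, \<bar>f\<^sub>N\<^sub>-\<^sub>1'\<bar>\<close> is attained, up to a constant that is independent of \<open>N\<close>,
  by derivatives of \<open>1\<close>-Lipschitz functions of the curve (\<open>max_derivative_integral_le\<close>). Split the interval into the sets
  \<open>A\<^sub>n\<close> on which \<open>\<bar>f\<^sub>n'\<bar>\<close> is the largest. If \<open>\<gamma>\<close> passes through the same points at times in \<open>A\<^sub>n\<close> and at
  times in \<open>A\<^sub>k\<close>, then except at countably many times the ratio of \<open>f\<^sub>n'\<close> to \<open>f\<^sub>k'\<close> is the same on both
  passages, which is impossible if \<open>\<bar>f\<^sub>n'\<bar> \<ge> \<bar>f\<^sub>k'\<bar>\<close> on the one and \<open>\<bar>f\<^sub>n'\<bar> < \<bar>f\<^sub>k'\<bar>\<close> on the other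
  (\<open>countable_crossings\<close>). Hence large compact parts of the sets \<open>A\<^sub>n\<close> have disjoint compact images. On images
  that are \<open>2 \<delta>\<close> apart, the functions \<open>\<delta> sin (dist x\<^sub>n / \<delta>)\<close> and
  \<open>\<delta> cos (dist x\<^sub>n / \<delta>)\<close> are so small that the pieces for different \<open>n\<close> fit together
  to \<open>1\<close>-Lipschitz functions (\<open>separated_oscillations\<close>), and the derivatives along \<open>\<gamma>\<close> of these two functions
  have the squares \<open>cos\<^sup>2 \<cdot> f\<^sub>n'\<^sup>2\<close> and \<open>sin\<^sup>2 \<cdot> f\<^sub>n'\<^sup>2\<close>. So the integral of the maximum to the power \<open>p\<close> is at most
  \<open>2\<^sup>p\<^sup>+\<^sup>1 C\<close>, and monotone convergence bounds \<open>G\<close>.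

  Derivatives exist almost everywhere because a function whose increments are dominated by an
  integral is itself an indefinite integral (Radon-Nikodym) and Lebesgue's differentiation
  theorem applies to it.
\<close>

section \<open>Functions with integrably dominated increments\<close>

lemma set_integrable_lborel_Icc:
  fixes g :: "real \<Rightarrow> real"
  assumes "integrable lborel g"
  shows "set_integrable lborel {s..t} g"
  using integrable_mult_indicator[of "{s..t}" lborel g] assms
  by (simp add: set_integrable_def)

lemma LINT_Icc_eq_integral:
  fixes g :: "real \<Rightarrow> real"
  assumes "integrable lborel g"
  shows "(LINT u:{s..t}|lborel. g u) = integral {s..t} g" and "g integrable_on {s..t}"
  using set_borel_integral_eq_integral[OF set_integrable_lborel_Icc[OF assms]] by auto

lemma nn_integral_Ioc_eq_integral:
  fixes g :: "real \<Rightarrow> real"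
  assumes g: "integrable lborel g" and pos: "\<And>x. 0 \<le> g x"
  shows "(\<integral>\<^sup>+x. ennreal (g x) * indicator {s<..t} x \<partial>lborel) = ennreal (integral {s..t} g)"
proof -
  have "(\<integral>\<^sup>+x. ennreal (g x) * indicator {s<..t} x \<partial>lborel)
      = (\<integral>\<^sup>+x. ennreal (indicator {s..t} x * g x) \<partial>lborel)"
    using AE_lborel_singleton[of s]
    by (intro nn_integral_cong_AE) (auto elim!: eventually_mono simp: indicator_def)
  also have "\<dots> = ennreal (integral\<^sup>L lborel (\<lambda>x. indicator {s..t} x * g x))"
    using set_integrable_lborel_Icc[OF g, of s t] pos
    by (intro nn_integral_eq_integral) (auto simp: set_integrable_def)
  also have "integral\<^sup>L lborel (\<lambda>x. indicator {s..t} x * g x) = integral {s..t} g"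
    using LINT_Icc_eq_integral(1)[OF g, of s t] by (simp add: set_lebesgue_integral_def)
  finally show ?thesis .
qed

lemma integral_diff_Icc:
  fixes g :: "real \<Rightarrow> real"
  assumes "integrable lborel g" "a \<le> s" "s \<le> t"
  shows "integral {a..t} g - integral {a..s} g = integral {s..t} g"
  using Henstock_Kurzweil_Integration.integral_combine[of a s t g] assms LINT_Icc_eq_integral(2)[OF assms(1)]
  by simp

lemma continuous_on_dominated_increments:
  fixes f :: "real \<Rightarrow> 'a::metric_space" and \<Gamma> :: "real \<Rightarrow> real"
  assumes "continuous_on S \<Gamma>" "\<And>s t. s \<in> S \<Longrightarrow> t \<in> S \<Longrightarrow> dist (f s) (f t) \<le> \<bar>\<Gamma> t - \<Gamma> s\<bar>"
  shows "continuous_on S f"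
  unfolding continuous_on_iff
proof (intro ballI allI impI)
  fix x e :: real assume "x \<in> S" "0 < e"
  then obtain d where "d>0" "\<forall>x'\<in>S. dist x' x < d \<longrightarrow> dist (\<Gamma> x') (\<Gamma> x) < e"
    using assms(1) unfolding continuous_on_iff by metis
  then show "\<exists>d>0. \<forall>x'\<in>S. dist x' x < d \<longrightarrow> dist (f x') (f x) < e"
    using assms(2)[OF \<open>x \<in> S\<close>] by (metis dist_commute dist_real_def le_less_trans)
qed

text \<open>
  With \<open>\<Gamma>\<close> an indefinite integral of \<open>G\<close>, both \<open>\<Gamma> + f\<close> and \<open>\<Gamma> - f\<close> are nondecreasing, and the sum of their
  Stieltjes measures is \<open>2 G\<close> times Lebesgue measure. Each of the two is therefore absolutely
  continuous, and a density of the first one minus \<open>G\<close> is a density for \<open>f\<close>.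
\<close>

lemma dominated_increments_imp_indefinite_integral:
  fixes f G :: "real \<Rightarrow> real"
  assumes ab: "a < b" and G: "integrable lborel G" "\<And>x. 0 \<le> G x"
    and bound: "\<And>s t. a \<le> s \<Longrightarrow> s \<le> t \<Longrightarrow> t \<le> b \<Longrightarrow> \<bar>f t - f s\<bar> \<le> integral {s..t} G"
  obtains g where "integrable lborel g"
    "\<And>s t. a \<le> s \<Longrightarrow> s \<le> t \<Longrightarrow> t \<le> b \<Longrightarrow> f t - f s = integral {s..t} g"
proof -
  define \<Gamma> where "\<Gamma> = (\<lambda>t. integral {a..t} G)"
  \<comment> \<open>Clamping to the interval makes the increments of \<open>f\<close> and \<open>\<Gamma>\<close> meaningful on the whole line,
    as \<open>interval_measure\<close> requires.\<close>
  define cl where "cl = (\<lambda>t. max a (min b t))"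
  have cl: "a \<le> cl t" "cl t \<le> b" "s \<le> t \<Longrightarrow> cl s \<le> cl t" for s t
    using ab by (auto simp: cl_def)
  have \<Gamma>: "\<Gamma> t - \<Gamma> s = integral {s..t} G" if "a \<le> s" "s \<le> t" for s t
    unfolding \<Gamma>_def by (rule integral_diff_Icc[OF G(1) that])
  have contG: "continuous_on {a..b} \<Gamma>"
    unfolding \<Gamma>_def by (rule indefinite_integral_continuous_1[OF LINT_Icc_eq_integral(2)[OF G(1)]])
  have contf: "continuous_on {a..b} f"
  proof (rule continuous_on_dominated_increments[OF contG])
    fix s t assume "s \<in> {a..b}" "t \<in> {a..b}"
    then show "dist (f s) (f t) \<le> \<bar>\<Gamma> t - \<Gamma> s\<bar>"
      using bound[of s t] bound[of t s] \<Gamma>[of s t] \<Gamma>[of t s] unfolding dist_real_def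
      by (cases "s \<le> t") auto
  qed
  have contcl: "continuous_on UNIV cl"
    unfolding cl_def by (intro continuous_intros)
  \<comment> \<open>The sign \<open>\<sigma> = \<plusminus>1\<close> selects \<open>\<Gamma> + f\<close> or \<open>\<Gamma> - f\<close>.\<close>
  define \<Phi> where "\<Phi> = (\<lambda>\<sigma> t. \<Gamma> (cl t) + \<sigma> * f (cl t))"
  have cont: "continuous_on UNIV (\<Phi> \<sigma>)" for \<sigma>
    unfolding \<Phi>_def
    by (intro continuous_intros continuous_on_compose2[OF contG contcl]
        continuous_on_compose2[OF contf contcl]) (use cl in auto)
  have mono: "\<Phi> \<sigma> s \<le> \<Phi> \<sigma> t" if "\<bar>\<sigma>\<bar> = 1" "s \<le> t" for \<sigma> s t
  proof -
    have "\<bar>\<sigma> * (f (cl t) - f (cl s))\<bar> \<le> \<Gamma> (cl t) - \<Gamma> (cl s)"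
      using bound[of "cl s" "cl t"] \<Gamma>[of "cl s" "cl t"] cl that by (simp add: abs_mult)
    then show ?thesis unfolding \<Phi>_def by (simp add: algebra_simps abs_le_iff)
  qed
  have right: "continuous (at_right x) (\<Phi> \<sigma>)" for x \<sigma>
    using cont[of \<sigma>] by (meson UNIV_I continuous_on_eq_continuous_within continuous_within_subset subset_UNIV)
  define M where "M = (\<lambda>\<sigma>. interval_measure (\<Phi> \<sigma>))"
  have sets_M[measurable_cong, simp]: "sets (M \<sigma>) = sets borel" for \<sigma> by (simp add: M_def)
  have M_Ioc: "emeasure (M \<sigma>) {s<..t} = ennreal (\<Phi> \<sigma> t - \<Phi> \<sigma> s)" if "\<bar>\<sigma>\<bar> = 1" "s \<le> t" for \<sigma> s t
    unfolding M_def using that mono[OF that(1)] right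
    by (intro emeasure_interval_measure_Ioc) auto
  define I where "I = {a<..b}"
  have [measurable]: "I \<in> sets borel" by (simp add: I_def)
  define \<nu> where "\<nu> = density lborel (\<lambda>x. ennreal (2 * G x))"
  have Gm[measurable]: "G \<in> borel_measurable borel" using G(1) by auto
  have [measurable_cong, simp]: "sets \<nu> = sets borel" by (simp add: \<nu>_def)
  have \<nu>_Ioc: "emeasure \<nu> {s<..t} = ennreal (2 * (\<Gamma> t - \<Gamma> s))" if "a \<le> s" "s \<le> t" for s t
    using that nn_integral_Ioc_eq_integral[of "\<lambda>x. 2 * G x" s t] G \<Gamma>[OF that]
    by (simp add: \<nu>_def emeasure_density)
  have base: "emeasure (M 1) ({s<..t} \<inter> I) + emeasure (M (-1)) ({s<..t} \<inter> I) = emeasure \<nu> ({s<..t} \<inter> I)" for s t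
  proof -
    have eq: "{s<..t} \<inter> I = {max s a<..min t b}" by (auto simp: I_def)
    show ?thesis
    proof (cases "max s a \<le> min t b")
      case True
      have c: "cl (max s a) = max s a" "cl (min t b) = min t b" using True ab by (auto simp: cl_def)
      have "ennreal (\<Phi> 1 (min t b) - \<Phi> 1 (max s a)) + ennreal (\<Phi> (-1) (min t b) - \<Phi> (-1) (max s a))
         = ennreal ((\<Phi> 1 (min t b) - \<Phi> 1 (max s a)) + (\<Phi> (-1) (min t b) - \<Phi> (-1) (max s a)))"
        using mono[of 1, OF _ True] mono[of "-1", OF _ True] by (subst ennreal_plus) auto
      also have "(\<Phi> 1 (min t b) - \<Phi> 1 (max s a)) + (\<Phi> (-1) (min t b) - \<Phi> (-1) (max s a))
          = 2 * (\<Gamma> (min t b) - \<Gamma> (max s a))"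
        unfolding \<Phi>_def c by (simp add: algebra_simps)
      finally show ?thesis unfolding eq using True M_Ioc[of 1] M_Ioc[of "-1"] \<nu>_Ioc by simp
    next
      case False
      then have "{s<..t} \<inter> I = {}" unfolding eq by auto
      then show ?thesis by simp
    qed
  qed
  have Ifin: "emeasure (M \<sigma>) I < \<infinity>" if "\<bar>\<sigma>\<bar> = 1" for \<sigma>
    using M_Ioc[OF that, of a b] ab by (simp add: I_def)
  have sum_M: "emeasure (M 1) (A \<inter> I) + emeasure (M (-1)) (A \<inter> I) = emeasure \<nu> (A \<inter> I)"
    if "A \<in> sets borel" for A
  proof -
    have "Int_stable (range (\<lambda>(a, b). {a <.. b::real}))"
      by (auto simp: Int_stable_def)
    moreover have "range (\<lambda>(a, b). {a <.. b::real}) \<subseteq> Pow UNIV" by simp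
    moreover have "A \<in> sigma_sets UNIV (range (\<lambda>(a, b). {a <.. b::real}))"
      using that unfolding borel_sigma_sets_Ioc by simp
    ultimately show ?thesis
    proof (induction rule: sigma_sets_induct_disjoint)
      case (basic A)
      then show ?case using base by auto
    next
      case empty
      show ?case by simp
    next
      case (compl A)
      have A[measurable]: "A \<in> sets borel"
        using compl(1) unfolding borel_sigma_sets_Ioc by simp
      have cp: "(UNIV - A) \<inter> I = I - (A \<inter> I)" by auto
      have I: "emeasure (M 1) I + emeasure (M (-1)) I = emeasure \<nu> I"
        using base[of a b] by (simp add: I_def)
      have fin: "emeasure (M \<sigma>) (A \<inter> I) \<noteq> \<infinity>" if "\<bar>\<sigma>\<bar> = 1" for \<sigma>
        using Ifin[OF that] emeasure_mono[of "A \<inter> I" I "M \<sigma>"] by (auto simp: top_unique)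
      have fin\<nu>: "emeasure \<nu> (A \<inter> I) \<noteq> \<infinity>"
        using compl(2) fin[of 1] fin[of "-1"] by (metis abs_1 abs_minus_cancel ennreal_add_eq_top infinity_ennreal_def)
      have d: "emeasure (M \<sigma>) (I - A \<inter> I) = emeasure (M \<sigma>) I - emeasure (M \<sigma>) (A \<inter> I)" if "\<bar>\<sigma>\<bar> = 1" for \<sigma>
        using fin[OF that] by (intro emeasure_Diff) auto
      have d\<nu>: "emeasure \<nu> (I - A \<inter> I) = emeasure \<nu> I - emeasure \<nu> (A \<inter> I)"
        using fin\<nu> by (intro emeasure_Diff) auto
      have le: "emeasure (M \<sigma>) (A \<inter> I) \<le> emeasure (M \<sigma>) I" for \<sigma> by (intro emeasure_mono) auto
      show ?case unfolding cp d[of 1, simplified] d[of "-1", simplified] d\<nu> I[symmetric] compl(2)[symmetric]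
        using add_diff_eq_ennreal[OF le] fin[of 1] fin[of "-1"] le[of 1] le[of "-1"]
        by (metis abs_1 abs_minus_cancel add_diff_eq_ennreal add.commute diff_add_eq_diff_diff_swap_ennreal  ennreal_minus_cancel_iff)
    next
      case (union A)
      have A[measurable]: "A i \<in> sets borel" for i
        using union(2) unfolding borel_sigma_sets_Ioc by auto
      have dj: "disjoint_family (\<lambda>i. A i \<inter> I)" using union(1) by (auto simp: disjoint_family_on_def)
      have "emeasure N (\<Union>(range A) \<inter> I) = (\<Sum>i. emeasure N (A i \<inter> I))" if "sets N = sets borel" for N
        using suminf_emeasure[OF _ dj, of N] that by (auto simp: image_subset_iff)
      then show ?case using union(3) by (simp add: suminf_add)
    qed
  qed
  \<comment> \<open>The comparison with \<open>\<nu>\<close> is valid inside the interval only.\<close>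
  define P where "P = density (M 1) (indicator I)"
  have "absolutely_continuous lborel P"
    unfolding absolutely_continuous_def
  proof
    fix A :: "real set" assume A: "A \<in> null_sets lborel"
    then have [measurable]: "A \<in> sets borel" by auto
    have "A \<in> null_sets \<nu>"
      using A absolutely_continuousI_density[of "\<lambda>x. ennreal (2 * G x)" lborel]
      unfolding absolutely_continuous_def \<nu>_def by auto
    then have "A \<inter> I \<in> null_sets \<nu>" by (rule null_set_Int2) simp
    then have "emeasure (M 1) (A \<inter> I) = 0" using sum_M[of A] by auto
    moreover have "emeasure P A = emeasure (M 1) (A \<inter> I)"
      unfolding P_def by (subst emeasure_density) (auto simp: Int_commute simp flip: indicator_inter_arith)
    ultimately show "A \<in> null_sets P" by (auto simp: P_def)
  qed
  then obtain h where h[measurable]: "h \<in> borel_measurable lborel" and hP: "density lborel h = P"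
    using sigma_finite_measure.Radon_Nikodym[OF sigma_finite_lborel, of P] by (auto simp: P_def)
  have h_int: "(\<integral>\<^sup>+x. h x * indicator {s<..t} x \<partial>lborel) = ennreal (\<Phi> 1 t - \<Phi> 1 s)" if "a \<le> s" "s \<le> t" "t \<le> b" for s t
  proof -
    have "emeasure P {s<..t} = emeasure (M 1) {s<..t}"
      unfolding P_def by (subst emeasure_density) (use that in \<open>auto simp: I_def Int_absorb2 Int_absorb1 simp flip: indicator_inter_arith\<close>)
    then show ?thesis using M_Ioc[of 1 s t] that by (simp flip: hP add: emeasure_density)
  qed
  define g where "g = (\<lambda>x. indicator I x * enn2real (h x) - indicator I x * G x)"
  define h' where "h' = (\<lambda>x. indicator I x * enn2real (h x))"
  have fin: "(\<integral>\<^sup>+x. h x * indicator I x \<partial>lborel) < \<infinity>"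
    using h_int[of a b] ab by (simp add: I_def)
  then have AEfin: "AE x in lborel. h x * indicator I x \<noteq> \<infinity>"
    by (intro nn_integral_PInf_AE) auto
  have h'eq: "AE x in lborel. ennreal (h' x) = h x * indicator I x"
    using AEfin by eventually_elim (auto simp: h'_def indicator_def less_top)
  have h'int: "integrable lborel h'"
  proof (rule integrableI_nonneg)
    show "h' \<in> borel_measurable lborel" unfolding h'_def by measurable
    show "AE x in lborel. 0 \<le> h' x" by (simp add: h'_def)
    show "(\<integral>\<^sup>+ x. ennreal (h' x) \<partial>lborel) < \<infinity>"
      using fin nn_integral_cong_AE[OF h'eq] by simp
  qed
  have geq: "g = (\<lambda>x. h' x - indicator I x * G x)" by (simp add: g_def h'_def)
  have h'pos: "0 \<le> h' x" for x by (simp add: h'_def)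
  have Gint: "integrable lborel (\<lambda>x. indicator I x * G x)"
    using integrable_mult_indicator[of I lborel G] G(1) by simp
  show thesis
  proof
    show gint: "integrable lborel g" unfolding g_def using h'int Gint by (auto simp: h'_def)
    fix s t assume st: "a \<le> s" "s \<le> t" "t \<le> b"
    have "ennreal (integral {s..t} h') = (\<integral>\<^sup>+x. ennreal (h' x) * indicator {s<..t} x \<partial>lborel)"
      by (rule nn_integral_Ioc_eq_integral[symmetric, OF h'int h'pos])
    also have "\<dots> = (\<integral>\<^sup>+x. h x * indicator {s<..t} x \<partial>lborel)"
      using h'eq st by (intro nn_integral_cong_AE) (auto elim!: eventually_mono simp: indicator_def I_def)
    also have "\<dots> = ennreal (\<Phi> 1 t - \<Phi> 1 s)" by (rule h_int[OF st])
    finally have "integral {s..t} h' = \<Phi> 1 t - \<Phi> 1 s"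
      using mono[of 1 s t] st h'pos Henstock_Kurzweil_Integration.integral_nonneg[OF LINT_Icc_eq_integral(2)[OF h'int]]
      by (subst (asm) ennreal_inj) auto
    moreover have "integral {s..t} (\<lambda>x. indicator I x * G x) = integral {s..t} G"
      by (rule integral_spike[of "{a}"]) (use st in \<open>auto simp: I_def indicator_def\<close>)
    moreover have "integral {s..t} g = integral {s..t} h' - integral {s..t} (\<lambda>x. indicator I x * G x)"
      unfolding geq
      using LINT_Icc_eq_integral(2)[OF h'int] LINT_Icc_eq_integral(2)[OF Gint]
      by (intro Henstock_Kurzweil_Integration.integral_diff)
    moreover have "cl s = s" "cl t = t" using st by (auto simp: cl_def)
    ultimately show "f t - f s = integral {s..t} g"
      using \<Gamma>[of s t] st by (simp add: \<Phi>_def)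
  qed
qed

text \<open>
  Lebesgue's differentiation theorem on the line. The one-sided averages converge by
  \<open>integrable_ccontinuous_explicit\<close>; applied to the reflected integrand, the same result gives the averages on the
  other side.
\<close>

lemma indefinite_integral_has_derivative_AE:
  fixes f g :: "real \<Rightarrow> real"
  assumes g: "integrable lborel g"
    and f: "\<And>s t. a \<le> s \<Longrightarrow> s \<le> t \<Longrightarrow> t \<le> b \<Longrightarrow> f t - f s = integral {s..t} g"
  shows "AE t in lborel. a < t \<longrightarrow> t < b \<longrightarrow> (f has_real_derivative g t) (at t)"
proof -
  have right: "AE t in lborel. \<forall>e>0. \<exists>d>0. \<forall>h. 0 < h \<and> h < d \<longrightarrow> \<bar>integral {t..t+h} g / h - g t\<bar> < e"
    if g: "integrable lborel g" for g :: "real \<Rightarrow> real"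
  proof -
    obtain N where N: "negligible N" "\<And>x e. \<lbrakk>x \<notin> N; 0 < e\<rbrakk> \<Longrightarrow> \<exists>d>0. \<forall>h. 0 < h \<and> h < d \<longrightarrow>
                         norm(integral (cbox x (x + h *\<^sub>R One)) g /\<^sub>R h ^ DIM(real) - g x) < e"
      using integrable_ccontinuous_explicit[of g] LINT_Icc_eq_integral(2)[OF g] by (auto simp: cbox_interval)
    have "AE t in lebesgue. t \<notin> N"
      using N(1) by (simp add: AE_not_in negligible_iff_null_sets)
    then have "AE t in lborel. t \<notin> N"
      by (simp add: AE_completion_iff)
    then show ?thesis
    proof eventually_elim
      case (elim t)
      show ?case using N(2)[OF elim] by (simp add: divide_inverse mult.commute)
    qed
  qed
  have "integrable lborel (\<lambda>x. g (- x))"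
    using lborel_integrable_real_affine[OF g, of "-1" 0] by simp
  from AE_E3[OF right[OF this]] obtain N where N: "N \<in> null_sets lborel" and
    N': "\<And>t. t \<notin> N \<Longrightarrow> \<forall>e>0. \<exists>d>0. \<forall>h. 0 < h \<and> h < d \<longrightarrow> \<bar>integral {t..t+h} (\<lambda>x. g (-x)) / h - g (-t)\<bar> < e"
    by (metis (no_types, lifting) Diff_iff UNIV_I space_borel space_lborel)
  have refl: "integral {-t..-t+h} (\<lambda>x. g (-x)) = integral {t-h..t} g" for t h
    using Henstock_Kurzweil_Integration.integral_reflect_real[of t "t-h" g] by simp
  have leftN: "\<forall>e>0. \<exists>d>0. \<forall>h. 0 < h \<and> h < d \<longrightarrow> \<bar>integral {t-h..t} g / h - g t\<bar> < e" if "-t \<notin> N" for t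
    using N'[OF that] unfolding refl by simp
  have left: "AE t in lborel. -t \<notin> N"
  proof -
    have "AE t in lborel. t \<notin> N" using N by (rule AE_not_in)
    moreover have "Measurable.pred borel (\<lambda>t. t \<notin> N)"
    proof -
      have [measurable]: "N \<in> sets borel" using N by auto
      show ?thesis by measurable
    qed
    ultimately show ?thesis
      using AE_borel_affine[of "-1" "\<lambda>t. t \<notin> N" 0] by simp
  qed
  show ?thesis
    using right[OF g] left
  proof eventually_elim
    case (elim t)
    show ?case
    proof (intro impI)
      assume t: "a < t" "t < b"
      have "((\<lambda>y. (f y - f t) / (y - t)) \<longlongrightarrow> g t) (at_right t)"
        unfolding tendsto_iff
      proof (intro allI impI)
        fix e :: real assume "0 < e"
        then obtain d where d: "d > 0" "\<And>h. 0 < h \<Longrightarrow> h < d \<Longrightarrow> \<bar>integral {t..t+h} g / h - g t\<bar> < e"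
          using elim(1) by meson
        show "\<forall>\<^sub>F y in at_right t. dist ((f y - f t) / (y - t)) (g t) < e"
          unfolding eventually_at_right_field
        proof (intro exI[of _ "min b (t + d)"] conjI allI impI)
          fix y assume y: "t < y" "y < min b (t + d)"
          show "dist ((f y - f t) / (y - t)) (g t) < e"
            using d(2)[of "y - t"] f[of t y] t y by (simp add: dist_real_def)
        qed (use t d in auto)
      qed
      moreover have "((\<lambda>y. (f y - f t) / (y - t)) \<longlongrightarrow> g t) (at_left t)"
        unfolding tendsto_iff
      proof (intro allI impI)
        fix e :: real assume "0 < e"
        then obtain d where d: "d > 0" "\<And>h. 0 < h \<Longrightarrow> h < d \<Longrightarrow> \<bar>integral {t-h..t} g / h - g t\<bar> < e"
          using leftN[OF elim(2)] by meson
        show "\<forall>\<^sub>F y in at_left t. dist ((f y - f t) / (y - t)) (g t) < e"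
          unfolding eventually_at_left_field
        proof (intro exI[of _ "max a (t - d)"] conjI allI impI)
          fix y assume y: "max a (t - d) < y" "y < t"
          have "(f y - f t) / (y - t) = (f t - f y) / (t - y)"
            by (metis minus_diff_eq minus_divide_divide)
          then show "dist ((f y - f t) / (y - t)) (g t) < e"
            using d(2)[of "t - y"] f[of y t] t y by (simp add: dist_real_def)
        qed (use t d in auto)
      qed
      ultimately show "(f has_real_derivative g t) (at t)"
        unfolding has_field_derivative_iff by (subst at_eq_sup_left_right) (rule filterlim_sup)
    qed
  qed
qed

section \<open>Curves with a dominating function in L_p\<close>

text \<open>
  On a bounded interval \<open>L\<^sub>p\<close> is contained in \<open>L\<^sub>1\<close>, because \<open>u \<le> 1 + u\<^sup>p\<close> for \<open>u \<ge> 0\<close>.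
\<close>

lemma integrable_if_powr_integrable:
  fixes f :: "real \<Rightarrow> real"
  assumes p: "1 \<le> p" and f: "f \<in> borel_measurable borel" "\<And>t. 0 \<le> f t" "\<And>t. t \<notin> {a..b} \<Longrightarrow> f t = 0"
    and fp: "integrable lborel (\<lambda>t. f t powr p)"
  shows "integrable lborel f"
proof (rule Bochner_Integration.integrable_bound)
  show "integrable lborel (\<lambda>t. indicator {a..b} t + f t powr p)"
    using fp by (intro Bochner_Integration.integrable_add integrable_real_indicator) (auto simp: emeasure_lborel_Icc_eq)
  show "AE t in lborel. norm (f t) \<le> norm (indicator {a..b} t + f t powr p)"
  proof (rule AE_I2)
    fix t
    show "norm (f t) \<le> norm (indicator {a..b} t + f t powr p)"
    proof (cases "t \<in> {a..b}")
      case True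
      have "f t \<le> 1 + f t powr p"
      proof (cases "f t \<le> 1")
        case False
        then have "f t powr 1 \<le> f t powr p" using p by (intro powr_mono) auto
        then show ?thesis using False by simp
      qed (simp add: add_increasing2)
      then show ?thesis using True f(2)[of t] by simp
    qed (simp add: f(3))
  qed
qed (use f(1) in auto)

text \<open>
  The Sobolev condition for a curve restricted to a set \<open>S\<close> of times. The dominating function lives on
  the whole line, so that the gauge integral and the Lebesgue integral over subintervals
  can be exchanged freely.
\<close>

definition Lp_dominated :: "real \<Rightarrow> real set \<Rightarrow> (real \<Rightarrow> 'a::metric_space) \<Rightarrow> bool" where
  "Lp_dominated p S c \<longleftrightarrow> (\<exists>G. integrable lborel G \<and> integrable lborel (\<lambda>x. G x powr p) \<and> (\<forall>x. 0 \<le> G x) \<and>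
     (\<forall>s\<in>S. \<forall>t\<in>S. s \<le> t \<longrightarrow> dist (c s) (c t) \<le> integral {s..t} G))"

lemma Lp_dominated_cong_subset:
  assumes "Lp_dominated p S c" "T \<subseteq> S" "\<And>t. t \<in> T \<Longrightarrow> c' t = c t"
  shows "Lp_dominated p T c'"
proof -
  obtain G where G: "integrable lborel G" "integrable lborel (\<lambda>x. G x powr p)" "\<And>x. 0 \<le> G x"
    "\<And>s t. s \<in> S \<Longrightarrow> t \<in> S \<Longrightarrow> s \<le> t \<Longrightarrow> dist (c s) (c t) \<le> integral {s..t} G"
    using assms(1) unfolding Lp_dominated_def by blast
  have "dist (c' s) (c' t) \<le> integral {s..t} G" if "s \<in> T" "t \<in> T" "s \<le> t" for s t
    using G(4)[of s t] that assms(2,3) by auto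
  then show ?thesis unfolding Lp_dominated_def using G by blast
qed

lemma Lp_dominated_lipschitz_comp:
  fixes \<gamma> :: "real \<Rightarrow> 'a::metric_space" and h :: "'a \<Rightarrow> 'b::metric_space"
  assumes "Lp_dominated p E \<gamma>" and h: "C-lipschitz_on UNIV h"
  shows "Lp_dominated p E (\<lambda>t. h (\<gamma> t))"
proof -
  obtain G where G: "integrable lborel G" "integrable lborel (\<lambda>x. G x powr p)" "\<And>x. 0 \<le> G x"
    "\<And>s t. s \<in> E \<Longrightarrow> t \<in> E \<Longrightarrow> s \<le> t \<Longrightarrow> dist (\<gamma> s) (\<gamma> t) \<le> integral {s..t} G"
    using assms(1) unfolding Lp_dominated_def by blast
  have C: "0 \<le> C" by (rule lipschitz_on_nonneg[OF h])
  show ?thesis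
    unfolding Lp_dominated_def
  proof (intro exI[of _ "\<lambda>x. C * G x"] conjI ballI impI allI)
    show "integrable lborel (\<lambda>x. C * G x)" using G(1) by simp
    show "integrable lborel (\<lambda>x. (C * G x) powr p)" using G(2,3) C by (simp add: powr_mult)
    show "0 \<le> C * G x" for x using C G(3) by simp
    fix s t assume st: "s \<in> E" "t \<in> E" "s \<le> t"
    have "dist (h (\<gamma> s)) (h (\<gamma> t)) \<le> C * dist (\<gamma> s) (\<gamma> t)" using h by (rule lipschitz_onD) auto
    also have "\<dots> \<le> C * integral {s..t} G" by (intro mult_left_mono G(4) st C)
    finally show "dist (h (\<gamma> s)) (h (\<gamma> t)) \<le> integral {s..t} (\<lambda>x. C * G x)" by simp
  qed
qed

lemma Lp_dominated_imp_continuous_on: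
  assumes "Lp_dominated p S c" "S \<subseteq> {a..b}"
  shows "continuous_on S c"
proof -
  obtain G where G: "integrable lborel G" "\<And>x. 0 \<le> G x"
    and c: "\<And>s t. s \<in> S \<Longrightarrow> t \<in> S \<Longrightarrow> s \<le> t \<Longrightarrow> dist (c s) (c t) \<le> integral {s..t} G"
    using assms(1) unfolding Lp_dominated_def by blast
  show ?thesis
  proof (rule continuous_on_dominated_increments)
    show "continuous_on S (\<lambda>t. integral {a..t} G)"
      using indefinite_integral_continuous_1[OF LINT_Icc_eq_integral(2)[OF G(1)]] assms(2)
      by (rule continuous_on_subset)
    have le: "dist (c s) (c t) \<le> \<bar>integral {a..t} G - integral {a..s} G\<bar>" if "s \<in> S" "t \<in> S" "s \<le> t" for s t
      using c[OF that] integral_diff_Icc[OF G(1), of a s t] that assms(2) by force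
    show "dist (c s) (c t) \<le> \<bar>integral {a..t} G - integral {a..s} G\<bar>" if "s \<in> S" "t \<in> S" for s t
      using le[of s t] le[of t s] that by (cases "s \<le> t") (auto simp: dist_commute abs_minus_commute)
  qed
qed

text \<open>
  Both sides of the inequality are continuous in the two times, so it passes to limits.
\<close>

lemma Lp_dominated_extend_dense:
  fixes c :: "real \<Rightarrow> 'a::metric_space"
  assumes dom: "Lp_dominated p S c" and sub: "S \<subseteq> T" "T \<subseteq> {a..b}" "T \<subseteq> closure S"
    and cont: "continuous_on T c"
  shows "Lp_dominated p T c"
proof -
  obtain G where G: "integrable lborel G" "integrable lborel (\<lambda>x. G x powr p)" "\<And>x. 0 \<le> G x"
    and c: "\<And>s t. s \<in> S \<Longrightarrow> t \<in> S \<Longrightarrow> s \<le> t \<Longrightarrow> dist (c s) (c t) \<le> integral {s..t} G"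
    using dom unfolding Lp_dominated_def by blast
  define \<Gamma> where "\<Gamma> = (\<lambda>t. integral {a..t} G)"
  have \<Gamma>: "\<Gamma> t - \<Gamma> s = integral {s..t} G" if "s \<in> T" "s \<le> t" for s t
    using integral_diff_Icc[OF G(1), of a s t] that sub by (auto simp: \<Gamma>_def)
  have contG: "continuous_on T \<Gamma>"
    unfolding \<Gamma>_def
    by (rule continuous_on_subset[OF indefinite_integral_continuous_1[OF LINT_Icc_eq_integral(2)[OF G(1)]] sub(2)])
  have \<Gamma>0: "0 \<le> integral {s..t} G" for s t
    using LINT_Icc_eq_integral(2)[OF G(1)] G(3) by (intro Henstock_Kurzweil_Integration.integral_nonneg) auto
  have le: "dist (c s) (c t) \<le> \<bar>\<Gamma> t - \<Gamma> s\<bar>" if st: "s \<in> S" "t \<in> S" for s t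
    using c[of s t] c[of t s] \<Gamma>[of s t] \<Gamma>[of t s] st sub(1)
    by (cases "s \<le> t") (auto simp: dist_commute abs_minus_commute)
  have "dist (c s) (c t) \<le> integral {s..t} G" if st: "s \<in> T" "t \<in> T" "s \<le> t" for s t
  proof -
    have "s \<in> closure S" "t \<in> closure S" using st sub(3) by blast+
    then obtain u v where u: "\<And>n. u n \<in> S" "u \<longlonglongrightarrow> s" and v: "\<And>n. v n \<in> S" "v \<longlonglongrightarrow> t"
      unfolding closure_sequential by blast
    have uT: "\<And>n. u n \<in> T" "\<And>n. v n \<in> T" using u(1) v(1) sub(1) by blast+
    have lim: "(\<lambda>n. f (u n)) \<longlonglongrightarrow> f s" "(\<lambda>n. f (v n)) \<longlonglongrightarrow> f t" if "continuous_on T f"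
      for f :: "real \<Rightarrow> 'b::metric_space"
      using continuous_on_tendsto_compose[OF that u(2) st(1)] continuous_on_tendsto_compose[OF that v(2) st(2)] uT by auto
    have "dist (c s) (c t) \<le> \<bar>\<Gamma> t - \<Gamma> s\<bar>"
    proof (rule LIMSEQ_le)
      show "(\<lambda>n. dist (c (u n)) (c (v n))) \<longlonglongrightarrow> dist (c s) (c t)" by (intro tendsto_dist lim cont)
      show "(\<lambda>n. \<bar>\<Gamma> (v n) - \<Gamma> (u n)\<bar>) \<longlonglongrightarrow> \<bar>\<Gamma> t - \<Gamma> s\<bar>" by (intro tendsto_rabs tendsto_diff lim contG)
    qed (use le u(1) v(1) in blast)
    also have "\<dots> = integral {s..t} G" using \<Gamma>[OF st(1,3)] \<Gamma>0 by simp
    finally show ?thesis .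
  qed
  then show ?thesis unfolding Lp_dominated_def using G by blast
qed

text \<open>
  Jensen's inequality for the mean value \<open>m\<close> of \<open>G\<close>: Young's inequality is the tangent
  inequality \<open>u\<^sup>p \<ge> p m\<^sup>p\<^sup>-\<^sup>1 u - (p - 1) m\<^sup>p\<close>, which is then integrated.
\<close>

lemma powr_integral_le:
  fixes G :: "real \<Rightarrow> real"
  assumes p: "1 < p" and st: "s < t" and G: "integrable lborel G" "\<And>x. 0 \<le> G x"
    and Gp: "integrable lborel (\<lambda>x. G x powr p)"
  shows "(integral {s..t} G) powr p * (t - s) powr (1 - p) \<le> integral {s..t} (\<lambda>x. G x powr p)"
proof -
  define m where "m = integral {s..t} G / (t - s)"
  note int = LINT_Icc_eq_integral(2)[OF G(1), of s t] LINT_Icc_eq_integral(2)[OF Gp, of s t]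
  have cint: "(\<lambda>x. c * G x) integrable_on {s..t}" for c
    using int(1) by (rule integrable_on_mult_right)
  have I0: "0 \<le> integral {s..t} G" using int G(2) by (intro Henstock_Kurzweil_Integration.integral_nonneg) auto
  have m0: "0 \<le> m" using I0 st by (simp add: m_def)
  have young: "p * m powr (p - 1) * u - (p - 1) * m powr p \<le> u powr p" if "0 \<le> u" for u
  proof -
    define q where "q = p / (p - 1)"
    have q: "1 < q" "1 / p + 1 / q = 1" using p by (auto simp: q_def field_simps)
    have "u * m powr (p - 1) \<le> u powr p / p + (m powr (p - 1)) powr q / q"
      using Youngs_inequality[of p q u "m powr (p - 1)"] p q that m0 by auto
    also have "(m powr (p - 1)) powr q = m powr p" using p by (simp add: powr_powr q_def)
    also have "m powr p / q = (p - 1) * m powr p / p" by (simp add: q_def)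
    finally have "p * (u * m powr (p - 1)) \<le> p * (u powr p / p + (p - 1) * m powr p / p)"
      using p by (intro mult_left_mono) auto
    also have "\<dots> = u powr p + (p - 1) * m powr p" using p by (simp add: distrib_left)
    finally show ?thesis by (simp add: mult_ac)
  qed
  have "integral {s..t} G powr p * (t - s) powr (1 - p) = m powr p * (t - s)"
    using st I0 by (simp add: m_def powr_divide powr_diff)
  also have "m powr p * (t - s) = p * m powr (p - 1) * integral {s..t} G - (p - 1) * m powr p * (t - s)"
  proof (cases "m = 0")
    case False
    have "m powr (p - 1) * integral {s..t} G = m powr (p - 1) * m * (t - s)" using st by (simp add: m_def)
    also have "m powr (p - 1) * m = m powr p" using False m0 by (simp add: powr_mult_base[of m "p - 1"] mult.commute)
    finally have "p * m powr (p - 1) * integral {s..t} G = p * (m powr p * (t - s))"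
      by (simp only: mult.assoc)
    then show ?thesis by (simp add: left_diff_distrib mult.assoc)
  qed (use I0 st p in \<open>simp add: m_def\<close>)
  also have "\<dots> = integral {s..t} (\<lambda>x. p * m powr (p - 1) * G x - (p - 1) * m powr p)"
    using int st cint by (subst Henstock_Kurzweil_Integration.integral_diff) auto
  also have "\<dots> \<le> integral {s..t} (\<lambda>x. G x powr p)"
    using young G(2) int cint
    by (intro integral_le Henstock_Kurzweil_Integration.integrable_diff) auto
  finally show ?thesis .
qed

lemma Lp_dominated_powr_increment:
  assumes p: "1 < p" and G: "integrable lborel G" "integrable lborel (\<lambda>x. G x powr p)" "\<And>x. 0 \<le> G x"
    and st: "s < t" and f: "dist u v \<le> integral {s..t} G"
  shows "(t - s) powr (1 - p) * dist u v powr p \<le> integral {s..t} (\<lambda>x. G x powr p)"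
proof -
  have "dist u v powr p \<le> integral {s..t} G powr p" using f p by (intro powr_mono2) auto
  then have "(t - s) powr (1 - p) * dist u v powr p \<le> (t - s) powr (1 - p) * integral {s..t} G powr p"
    by (intro mult_left_mono) auto
  also have "\<dots> \<le> integral {s..t} (\<lambda>x. G x powr p)"
    using powr_integral_le[OF p st G(1,3,2)] by (simp only: mult.commute)
  finally show ?thesis .
qed

section \<open>Uniform boundedness for Lipschitz functions\<close>

lemma powr_abs_add_le:
  fixes u v p :: real
  assumes "0 \<le> p"
  shows "\<bar>u + v\<bar> powr p \<le> 2 powr p * (\<bar>u\<bar> powr p + \<bar>v\<bar> powr p)"
proof -
  have "\<bar>u + v\<bar> powr p \<le> (2 * max \<bar>u\<bar> \<bar>v\<bar>) powr p"
    using assms by (intro powr_mono2) auto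
  also have "\<dots> = 2 powr p * max \<bar>u\<bar> \<bar>v\<bar> powr p" by (simp add: powr_mult)
  also have "max \<bar>u\<bar> \<bar>v\<bar> powr p \<le> \<bar>u\<bar> powr p + \<bar>v\<bar> powr p" by (auto simp: max_def)
  finally show ?thesis by simp
qed

lemma powr_abs_le_add_diff:
  fixes u v p :: real
  assumes "0 \<le> p"
  shows "\<bar>u\<bar> powr p \<le> \<bar>v + u\<bar> powr p + \<bar>v - u\<bar> powr p"
proof -
  have "\<bar>u\<bar> \<le> \<bar>v + u\<bar> \<or> \<bar>u\<bar> \<le> \<bar>v - u\<bar>" by linarith
  then have "\<bar>u\<bar> powr p \<le> \<bar>v + u\<bar> powr p \<or> \<bar>u\<bar> powr p \<le> \<bar>v - u\<bar> powr p"
    using assms by (auto intro: powr_mono2)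
  then show ?thesis by (smt (verit) powr_ge_zero)
qed

text \<open>
  For points \<open>u = \<gamma> s\<close>, \<open>v = \<gamma> t\<close> and the weight \<open>w = \<bar>t - s\<bar>\<^sup>1\<^sup>-\<^sup>p\<close>, a summand is the power \<open>p\<close> of a
  difference quotient of \<open>h \<circ> \<gamma>\<close>, integrated over an interval of length \<open>\<bar>t - s\<bar>\<close>. Lists are used
  since different increments of a curve may have the same endpoints and weights.
\<close>

definition weighted_variation :: "real \<Rightarrow> ('a \<times> 'a \<times> real) list \<Rightarrow> ('a \<Rightarrow> real) \<Rightarrow> real" where
  "weighted_variation p P h = (\<Sum>(u, v, w)\<leftarrow>P. w * \<bar>h u - h v\<bar> powr p)"

text \<open>
  The common form of the inequalities between weighted variations below, each of which holds
  summand by summand.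
\<close>

lemma weighted_variation_mono:
  assumes "\<And>u v w. (u, v, w) \<in> set P \<Longrightarrow>
    w * \<bar>f u - f v\<bar> powr p \<le> c * (w * \<bar>g u - g v\<bar> powr p) + d * (w * \<bar>h u - h v\<bar> powr p)"
  shows "weighted_variation p P f \<le> c * weighted_variation p P g + d * weighted_variation p P h"
  using assms
  by (induction P) (force simp: weighted_variation_def algebra_simps)+

lemma weighted_variation_add_le:
  assumes "0 \<le> p" "\<And>u v w. (u, v, w) \<in> set P \<Longrightarrow> 0 \<le> w"
  shows "weighted_variation p P (\<lambda>x. f x + g x)
    \<le> 2 powr p * weighted_variation p P f + 2 powr p * weighted_variation p P g"
proof (rule weighted_variation_mono)
  fix u v w assume "(u, v, w) \<in> set P"
  then show "w * \<bar>(f u + g u) - (f v + g v)\<bar> powr p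
      \<le> 2 powr p * (w * \<bar>f u - f v\<bar> powr p) + 2 powr p * (w * \<bar>g u - g v\<bar> powr p)"
  proof -
    have "(f u + g u) - (f v + g v) = (f u - f v) + (g u - g v)" by simp
    then show ?thesis
      using mult_left_mono[OF powr_abs_add_le[OF assms(1), of "f u - f v" "g u - g v"], of w]
        assms(2)[OF \<open>(u, v, w) \<in> set P\<close>] by (simp only: distrib_left mult.left_commute)
  qed
qed

lemma weighted_variation_le_add_diff:
  assumes "0 \<le> p" "\<And>u v w. (u, v, w) \<in> set P \<Longrightarrow> 0 \<le> w"
  shows "weighted_variation p P f
    \<le> 1 * weighted_variation p P (\<lambda>x. g x + f x) + 1 * weighted_variation p P (\<lambda>x. g x - f x)"
proof (rule weighted_variation_mono)
  fix u v w assume "(u, v, w) \<in> set P"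
  then show "w * \<bar>f u - f v\<bar> powr p \<le> 1 * (w * \<bar>(g u + f u) - (g v + f v)\<bar> powr p)
      + 1 * (w * \<bar>(g u - f u) - (g v - f v)\<bar> powr p)"
  proof -
    have "(g u + f u) - (g v + f v) = (g u - g v) + (f u - f v)"
      "(g u - f u) - (g v - f v) = (g u - g v) - (f u - f v)" by simp_all
    then show ?thesis
      using mult_left_mono[OF powr_abs_le_add_diff[OF assms(1), of "f u - f v" "g u - g v"], of w]
        assms(2)[OF \<open>(u, v, w) \<in> set P\<close>] by (simp only: distrib_left mult_1)
  qed
qed

lemma weighted_variation_scale:
  "weighted_variation p P (\<lambda>x. c * f x) = \<bar>c\<bar> powr p * weighted_variation p P f"
proof (induction P)
  case (Cons e P)
  obtain u v w where e: "e = (u, v, w)" by (cases e)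
  have "\<bar>c * f u - c * f v\<bar> powr p = \<bar>c\<bar> powr p * \<bar>f u - f v\<bar> powr p"
    by (simp add: abs_mult powr_mult flip: right_diff_distrib)
  then show ?case
    using Cons.IH by (simp add: weighted_variation_def e distrib_left mult.left_commute)
qed (simp add: weighted_variation_def)

lemma weighted_variation_lipschitz_le:
  assumes "0 \<le> p" "\<And>u v w. (u, v, w) \<in> set P \<Longrightarrow> 0 \<le> w" "1-lipschitz_on UNIV f"
  shows "weighted_variation p P f \<le> (\<Sum>(u, v, w)\<leftarrow>P. w * dist u v powr p)"
  unfolding weighted_variation_def
proof (rule sum_list_mono, clarsimp)
  fix u v w assume uvw: "(u, v, w) \<in> set P"
  have "\<bar>f u - f v\<bar> \<le> dist u v"
    using lipschitz_onD[OF assms(3), of u v] by (simp add: dist_real_def)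
  then show "w * \<bar>f u - f v\<bar> powr p \<le> w * dist u v powr p"
    using assms(1) assms(2)[OF uvw] by (intro mult_left_mono powr_mono2) auto
qed

text \<open>
  The uniform boundedness principle on the space of Lipschitz functions, by a gliding hump as
  in Sokal's elementary proof. Suppose that lists \<open>P k\<close> and \<open>1\<close>-Lipschitz \<open>h k\<close> have rapidly growing
  variations. A partial sum of a series \<open>\<Sum>k. \<plusminus> r ^ k * h k\<close> is changed by adding or subtracting the next term;
  for one of the two signs, the variation of the new partial sum along \<open>P k\<close> is at least half of that of the
  term itself. The remaining terms form a function with so small a Lipschitz constant that they cannot undo this,
  and so the limit has unbounded variations.
\<close>

lemma weighted_variation_uniform_bound:
  fixes PP :: "('a::metric_space \<times> 'a \<times> real) list set"
  assumes p: "1 \<le> p"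
    and weights: "\<And>P u v w. P \<in> PP \<Longrightarrow> (u, v, w) \<in> set P \<Longrightarrow> 0 \<le> w"
    and bounded: "\<And>h. (\<exists>C. C-lipschitz_on UNIV h) \<Longrightarrow> \<exists>B. \<forall>P\<in>PP. weighted_variation p P h \<le> B"
  obtains C where "0 \<le> C"
    "\<And>P h. P \<in> PP \<Longrightarrow> 1-lipschitz_on UNIV h \<Longrightarrow> weighted_variation p P h \<le> C"
proof (rule ccontr)
  assume no: "\<not> thesis"
  note bound_thesis = that
  have unb: "\<exists>P\<in>PP. \<exists>h. 1-lipschitz_on UNIV h \<and> weighted_variation p P h > C" if "0 \<le> C" for C
    using bound_thesis[OF that] no not_le by blast
  define S where "S = (\<lambda>P. SUP h\<in>{h::'a\<Rightarrow>real. 1-lipschitz_on UNIV h}. weighted_variation p P h)"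
  have bdd: "bdd_above (weighted_variation p P ` {h::'a\<Rightarrow>real. 1-lipschitz_on UNIV h})" if "P \<in> PP" for P
    using weighted_variation_lipschitz_le[of p P] weights[OF that] p by (intro bdd_aboveI2) auto
  have S_upper: "weighted_variation p P h \<le> S P" if "P \<in> PP" "1-lipschitz_on UNIV h" for P and h :: "'a \<Rightarrow> real"
    unfolding S_def using that by (intro cSUP_upper bdd) auto
  \<comment> \<open>The tail after the \<open>k\<close>-th term has Lipschitz constant at most \<open>2 r\<^sup>k\<^sup>+\<^sup>1\<close>; the ratio is so small that
    \<open>(4 r)\<^sup>p \<le> 1/8\<close>, which leaves half of the lower bound \<open>(r\<^sup>k)\<^sup>p S / 4\<close> after the tail is removed.\<close>
  define r :: real where "r = 1/32"
  have r: "0 < r" "r < 1" by (auto simp: r_def)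
  have "\<exists>P h. P \<in> PP \<and> 1-lipschitz_on UNIV h \<and> weighted_variation p P h \<ge> S P / 2 \<and>
      S P \<ge> 8 * 2 powr p * k / (r ^ k) powr p \<and> 0 \<le> S P" for k :: nat
  proof -
    obtain P h where P: "P \<in> PP" "1-lipschitz_on UNIV h" "weighted_variation p P h > 8 * 2 powr p * k / (r ^ k) powr p"
      using unb[of "8 * 2 powr p * k / (r ^ k) powr p"] by auto
    have pos: "0 < S P"
      using P(3) S_upper[OF P(1,2)] by (smt (verit) divide_nonneg_nonneg mult_nonneg_nonneg of_nat_0_le_iff powr_ge_zero)
    then have "S P / 2 < S P" by simp
    then obtain h' where "1-lipschitz_on UNIV h'" "S P / 2 < weighted_variation p P h'"
      unfolding S_def less_cSUP_iff[OF _ bdd[OF P(1)]]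
      using less_cSUP_iff[OF _ bdd[OF P(1)], of "S P / 2"] P(2) unfolding S_def by auto
    then show ?thesis using P pos S_upper[OF P(1,2)] by (intro exI[of _ P] exI[of _ h']) auto
  qed
  then obtain P h where Ph: "\<And>k. P k \<in> PP" "\<And>k. 1-lipschitz_on UNIV (h k :: 'a \<Rightarrow> real)"
      "\<And>k. weighted_variation p (P k) (h k) \<ge> S (P k) / 2"
      "\<And>k. S (P k) \<ge> 8 * 2 powr p * real k / (r ^ k) powr p" "\<And>k. 0 \<le> S (P k)"
    by metis
  fix x0 :: 'a
  \<comment> \<open>Normalising at a base point makes the series converge at every point.\<close>
  define h0 where "h0 = (\<lambda>k x. h k x - h k x0)"
  have h0: "\<bar>h0 k u - h0 k v\<bar> \<le> dist u v" "h0 k x0 = 0" for k u v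
    using lipschitz_onD[OF Ph(2)[of k], of u v] by (auto simp: h0_def dist_real_def)
  have h0_wv: "weighted_variation p (P k) (h0 k) \<ge> S (P k) / 2" for k
    using Ph(3)[of k] by (simp add: weighted_variation_def h0_def)
  define y :: "nat \<Rightarrow> 'a \<Rightarrow> real" where
    "y = rec_nat (\<lambda>x. 0) (\<lambda>k g. if weighted_variation p (P k) (\<lambda>x. g x + r ^ k * h0 k x) \<ge> (r ^ k) powr p * S (P k) / 4
            then (\<lambda>x. g x + r ^ k * h0 k x) else (\<lambda>x. g x - r ^ k * h0 k x))"
  define \<sigma> :: "nat \<Rightarrow> real" where "\<sigma> k = (if weighted_variation p (P k) (\<lambda>x. y k x + r ^ k * h0 k x) \<ge> (r ^ k) powr p * S (P k) / 4 then 1 else -1)" for k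
  have y_Suc: "y (Suc k) x = y k x + \<sigma> k * r ^ k * h0 k x" for k x
    by (simp add: y_def \<sigma>_def)
  have y_sum: "y n x = (\<Sum>k<n. \<sigma> k * r ^ k * h0 k x)" for n x
    by (induction n) (simp_all add: y_Suc, simp add: y_def)
  have y_large: "weighted_variation p (P k) (y (Suc k)) \<ge> (r ^ k) powr p * S (P k) / 4" for k
  proof (cases "\<sigma> k = 1")
    case True
    then have "weighted_variation p (P k) (\<lambda>x. y k x + r ^ k * h0 k x) \<ge> (r ^ k) powr p * S (P k) / 4"
      by (auto simp: \<sigma>_def split: if_splits)
    moreover have "y (Suc k) = (\<lambda>x. y k x + r ^ k * h0 k x)" using True by (simp add: y_Suc fun_eq_iff)
    ultimately show ?thesis by simp
  next
    case False
    then have 1: "weighted_variation p (P k) (\<lambda>x. y k x + r ^ k * h0 k x) < (r ^ k) powr p * S (P k) / 4" and "\<sigma> k = -1"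
      by (auto simp: \<sigma>_def split: if_splits)
    then have 2: "y (Suc k) = (\<lambda>x. y k x - r ^ k * h0 k x)" by (simp add: y_Suc fun_eq_iff)
    have "(r ^ k) powr p * (S (P k) / 2) \<le> weighted_variation p (P k) (\<lambda>x. r ^ k * h0 k x)"
      using h0_wv[of k] r by (simp add: weighted_variation_scale mult_left_mono)
    also have "\<dots> \<le> weighted_variation p (P k) (\<lambda>x. y k x + r ^ k * h0 k x) + weighted_variation p (P k) (y (Suc k))"
      using weighted_variation_le_add_diff[of p "P k" "\<lambda>x. r ^ k * h0 k x" "y k"] weights[OF Ph(1)] p unfolding 2 by simp
    finally show ?thesis using 1 by simp
  qed
  define x where "x = (\<lambda>z. \<Sum>k. \<sigma> k * r ^ k * h0 k z)"
  have geo: "summable (\<lambda>j. r ^ j * D)" "(\<Sum>j. r ^ j * D) \<le> 2 * D" if "0 \<le> D" for D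
  proof -
    have sr: "summable (\<lambda>j. r ^ j)" using r by (intro summable_geometric) simp
    show "summable (\<lambda>j. r ^ j * D)" by (rule summable_mult2[OF sr])
    have "suminf (\<lambda>j. r ^ j) = 32 / 31" using suminf_geometric[of r] by (simp add: r_def)
    then have "(\<Sum>j. r ^ j * D) = 32 / 31 * D"
      by (simp only: suminf_mult2[OF sr, of D, symmetric])
    also have "\<dots> \<le> 2 * D" using that by simp
    finally show "(\<Sum>j. r ^ j * D) \<le> 2 * D" .
  qed
  have term_bound: "\<bar>\<sigma> k * r ^ k * h0 k u - \<sigma> k * r ^ k * h0 k v\<bar> \<le> r ^ k * dist u v" for k u v
  proof -
    have "\<bar>\<sigma> k * r ^ k * h0 k u - \<sigma> k * r ^ k * h0 k v\<bar> = r ^ k * \<bar>h0 k u - h0 k v\<bar>"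
      using r by (auto simp: \<sigma>_def abs_mult simp flip: right_diff_distrib)
    then show ?thesis using h0(1)[of k u v] r by (simp add: mult_left_mono)
  qed
  have summ: "summable (\<lambda>k. \<sigma> k * r ^ k * h0 k z)" for z
    by (rule summable_comparison_test[OF _ geo(1)[of "dist z x0"]])
      (use term_bound[of _ z x0] h0(2) in auto)
  have tail: "\<bar>(x u - y n u) - (x v - y n v)\<bar> \<le> 2 * r ^ n * dist u v" for n u v
  proof -
    let ?D = "\<lambda>k. \<sigma> k * r ^ k * h0 k u - \<sigma> k * r ^ k * h0 k v"
    have s: "summable ?D" by (intro summable_diff summ)
    have "(x u - y n u) - (x v - y n v) = suminf ?D - (\<Sum>k<n. ?D k)"
      by (simp add: x_def y_sum suminf_diff[OF summ summ, symmetric] sum_subtractf)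
    also have "\<dots> = (\<Sum>k. ?D (k + n))"
      by (rule suminf_minus_initial_segment[OF s, symmetric])
    finally have "\<bar>(x u - y n u) - (x v - y n v)\<bar> = \<bar>\<Sum>k. ?D (k + n)\<bar>" by simp
    also have "\<dots> \<le> (\<Sum>k. r ^ k * (r ^ n * dist u v))"
    proof -
      have b: "\<bar>?D (k + n)\<bar> \<le> r ^ k * (r ^ n * dist u v)" for k
        using term_bound[of "k + n" u v] by (simp add: power_add mult_ac)
      have g: "summable (\<lambda>k. r ^ k * (r ^ n * dist u v))" using r by (intro geo(1)) simp
      have a: "summable (\<lambda>k. \<bar>?D (k + n)\<bar>)"
        by (rule summable_comparison_test[OF _ g]) (use b in auto)
      show ?thesis
        using summable_rabs[OF a] suminf_le[OF b a g] by linarith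
    qed
    also have "\<dots> \<le> 2 * (r ^ n * dist u v)" using r by (intro geo(2)) simp
    finally show ?thesis by simp
  qed
  have "2-lipschitz_on UNIV x"
    using tail[of _ 0] by (intro lipschitz_onI) (auto simp: y_sum dist_real_def)
  then obtain B where B: "\<And>P. P \<in> PP \<Longrightarrow> weighted_variation p P x \<le> B"
    using bounded by blast
  have "real k \<le> weighted_variation p (P k) x" for k
  proof -
    let ?d = "2 * r ^ Suc k"
    define c where "c = (\<lambda>z. (y (Suc k) z - x z) / ?d)"
    have "1-lipschitz_on UNIV c"
    proof (rule lipschitz_onI)
      fix u v
      have "dist (c u) (c v) = \<bar>(x u - y (Suc k) u) - (x v - y (Suc k) v)\<bar> / ?d"
      proof -
        have "c u - c v = - ((x u - y (Suc k) u) - (x v - y (Suc k) v)) / ?d"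
          unfolding c_def diff_divide_distrib[symmetric] by (simp del: power_Suc)
        then show ?thesis using r by (simp del: power_Suc add: dist_real_def abs_divide)
      qed
      also have "\<dots> \<le> ?d * dist u v / ?d" using r by (intro divide_right_mono tail) auto
      finally show "dist (c u) (c v) \<le> 1 * dist u v" using r by simp
    qed simp
    then have c: "weighted_variation p (P k) c \<le> S (P k)" by (rule S_upper[OF Ph(1)])
    let ?A = "(r ^ k) powr p * S (P k)" and ?X = "weighted_variation p (P k) x"
    have A: "0 \<le> ?A" using Ph(5)[of k] by simp
    have "?A / 4 \<le> weighted_variation p (P k) (\<lambda>z. x z + ?d * c z)"
      using y_large[of k] r by (simp add: c_def)
    also have "\<dots> \<le> 2 powr p * ?X + 2 powr p * weighted_variation p (P k) (\<lambda>z. ?d * c z)"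
      using weights[OF Ph(1)] p by (intro weighted_variation_add_le) auto
    finally have 1: "?A / 4 \<le> 2 powr p * ?X + 2 powr p * weighted_variation p (P k) (\<lambda>z. ?d * c z)" .
    have "weighted_variation p (P k) (\<lambda>z. ?d * c z) = ?d powr p * weighted_variation p (P k) c"
      using r unfolding weighted_variation_scale by simp
    also have "\<dots> \<le> ?d powr p * S (P k)" using c by (simp add: mult_left_mono)
    finally have "2 powr p * weighted_variation p (P k) (\<lambda>z. ?d * c z) \<le> (2 powr p * ?d powr p) * S (P k)"
      by (simp add: mult.assoc)
    also have "2 powr p * ?d powr p = (4 * r) powr p * (r ^ k) powr p"
      using r by (simp add: mult.assoc flip: powr_mult)
    also have "(4 * r) powr p * (r ^ k) powr p * S (P k) = (4 * r) powr p * ?A" by simp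
    also have "\<dots> \<le> 1 / 8 * ?A"
      using powr_mono'[of 1 p "1/8"] p A by (intro mult_right_mono) (auto simp: r_def)
    finally have "?A / 8 \<le> 2 powr p * ?X" using 1 by simp
    moreover have "2 powr p * real k \<le> (r ^ k) powr p * S (P k) / 8"
    proof -
      have "8 * 2 powr p * real k \<le> S (P k) * (r ^ k) powr p"
        using Ph(4)[of k] r by (subst (asm) pos_divide_le_eq) auto
      then show ?thesis by (simp add: mult.commute)
    qed
    ultimately have "2 powr p * real k \<le> 2 powr p * ?X" by (rule order_trans[rotated])
    then show ?thesis by simp
  qed
  then have "real k \<le> B" for k using B[OF Ph(1)[of k]] by (rule order_trans)
  then show False by (meson not_le reals_Archimedean2)
qed

section \<open>Derivatives of compositions with Lipschitz functions\<close>

text \<open>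
  Both endpoints are compared with the intermediate point \<open>t\<close>, and the two errors are proportional to the
  distances to \<open>t\<close>, which add up to \<open>v n - u n\<close>.
\<close>

lemma straddle_derivative:
  fixes f :: "real \<Rightarrow> real"
  assumes f: "(f has_real_derivative D) (at t)"
    and u: "u \<longlonglongrightarrow> t" and v: "v \<longlonglongrightarrow> t" and uv: "\<And>n. u n \<le> t" "\<And>n. t \<le> v n" "\<And>n. u n < v n"
  shows "(\<lambda>n. (f (v n) - f (u n)) / (v n - u n)) \<longlonglongrightarrow> D"
proof (rule tendstoI)
  fix e :: real assume e: "0 < e"
  have "((\<lambda>y. (f y - f t) / (y - t)) \<longlongrightarrow> D) (at t)"
    using f by (simp add: has_field_derivative_iff)
  from tendstoD[OF this, of "e/2"] e obtain d where d: "d > 0"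
      "\<And>y. y \<noteq> t \<Longrightarrow> \<bar>y - t\<bar> < d \<Longrightarrow> \<bar>(f y - f t) / (y - t) - D\<bar> < e / 2"
    unfolding eventually_at by (auto simp: dist_real_def)
  have near: "\<bar>f y - f t - D * (y - t)\<bar> \<le> e / 2 * \<bar>y - t\<bar>" if "\<bar>y - t\<bar> < d" for y
  proof (cases "y = t")
    case False
    have "(f y - f t) / (y - t) * (y - t) = f y - f t" using False by simp
    then have "f y - f t - D * (y - t) = ((f y - f t) / (y - t) - D) * (y - t)"
      by (simp only: left_diff_distrib)
    then show ?thesis
      using mult_right_mono[OF less_imp_le[OF d(2)[OF False that]] abs_ge_zero[of "y - t"]]
      by (simp only: abs_mult)
  qed simp
  have "\<forall>\<^sub>F n in sequentially. \<bar>u n - t\<bar> < d" "\<forall>\<^sub>F n in sequentially. \<bar>v n - t\<bar> < d"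
    using tendstoD[OF u d(1)] tendstoD[OF v d(1)] by (simp_all add: dist_real_def)
  then show "\<forall>\<^sub>F n in sequentially. dist ((f (v n) - f (u n)) / (v n - u n)) D < e"
  proof eventually_elim
    case (elim n)
    have h: "0 < v n - u n" using uv(3)[of n] by simp
    have "f (v n) - f (u n) - D * (v n - u n) = (f (v n) - f t - D * (v n - t)) - (f (u n) - f t - D * (u n - t))"
      by (simp add: algebra_simps)
    then have "\<bar>f (v n) - f (u n) - D * (v n - u n)\<bar> \<le> e / 2 * \<bar>v n - t\<bar> + e / 2 * \<bar>u n - t\<bar>"
      using near[OF elim(1)] near[OF elim(2)] by linarith
    also have "\<dots> = e / 2 * (v n - u n)" using uv(1,2)[of n] by (simp add: distrib_left[symmetric])
    finally have *: "\<bar>f (v n) - f (u n) - D * (v n - u n)\<bar> \<le> e / 2 * (v n - u n)" .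
    have "(f (v n) - f (u n)) / (v n - u n) - D = (f (v n) - f (u n) - D * (v n - u n)) / (v n - u n)"
      using h by (simp add: diff_divide_distrib)
    then have "\<bar>(f (v n) - f (u n)) / (v n - u n) - D\<bar> = \<bar>f (v n) - f (u n) - D * (v n - u n)\<bar> / (v n - u n)"
      using h by (simp add: abs_divide)
    also have "\<dots> \<le> e / 2" using * h by (simp add: pos_divide_le_eq)
    finally show ?case using e by (simp add: dist_real_def)
  qed
qed

definition grid :: "real \<Rightarrow> real \<Rightarrow> nat \<Rightarrow> nat \<Rightarrow> real" where
  "grid a b n i = a + (b - a) / Suc n * i"

lemma grid_step: "grid a b n (Suc i) - grid a b n i = (b - a) / Suc n"
  unfolding grid_def of_nat_Suc[of i] distrib_left by (simp del: of_nat_Suc)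

lemma grid_mono:
  assumes "a < b" "i \<le> j"
  shows "grid a b n i \<le> grid a b n j"
  unfolding grid_def using assms by (intro add_left_mono mult_left_mono) auto

lemma grid_ends: "grid a b n 0 = a" "grid a b n (Suc n) = b"
  by (simp_all add: grid_def del: of_nat_Suc)

lemma grid_cell:
  assumes "a < b" "a \<le> t" "t < b"
  obtains i where "i < Suc n" "grid a b n i \<le> t" "t < grid a b n (Suc i)"
proof -
  have "\<exists>k\<le>Suc n. (\<forall>i<k. \<not> t < grid a b n i) \<and> t < grid a b n k"
    by (rule ex_least_nat_le) (use assms grid_ends[of a b n] in auto)
  then obtain k where k: "k \<le> Suc n" "\<And>i. i < k \<Longrightarrow> grid a b n i \<le> t" "t < grid a b n k"
    by (auto simp: not_less)
  have "k \<noteq> 0" using k(3) assms(2) grid_ends(1)[of a b n] by (metis not_le)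
  then obtain i where "k = Suc i" using not0_implies_Suc by blast
  then show thesis using k by (intro that[of i]) auto
qed

text \<open>
  The difference quotients over the cells of the grid form step functions \<open>S n\<close> that converge to the power of
  the derivative wherever the latter exists, and Fatou's lemma transfers the bound on their integrals.
\<close>

lemma derivative_powr_integral_le:
  fixes f g :: "real \<Rightarrow> real"
  assumes ab: "a < b" and p: "1 < p" and g[measurable]: "g \<in> borel_measurable borel"
    and deriv: "AE t in lborel. a < t \<longrightarrow> t < b \<longrightarrow> (f has_real_derivative g t) (at t)"
    and bound: "\<And>n. (\<Sum>i<Suc n. ((b - a) / Suc n) powr (1 - p) * \<bar>f (grid a b n (Suc i)) - f (grid a b n i)\<bar> powr p) \<le> C"
  shows "(\<integral>\<^sup>+t. ennreal (\<bar>g t\<bar> powr p) * indicator {a..b} t \<partial>lborel) \<le> ennreal C"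
proof -
  define q where "q = (\<lambda>n i. \<bar>(f (grid a b n (Suc i)) - f (grid a b n i)) / ((b - a) / Suc n)\<bar> powr p)"
  define S where "S = (\<lambda>n t. \<Sum>i<Suc n. ennreal (q n i) * indicator {grid a b n i..<grid a b n (Suc i)} t)"
  have q0: "0 \<le> q n i" for n i by (simp add: q_def)
  have scale: "\<bar>x / L\<bar> powr p * L = L powr (1 - p) * \<bar>x\<bar> powr p" if "0 < L" for x L :: real
    using that by (simp add: abs_divide powr_divide powr_diff)
  have len: "0 < (b - a) / Suc n" for n using ab by simp
  have "(\<integral>\<^sup>+t. S n t \<partial>lborel) \<le> ennreal C" for n
  proof -
    have le: "grid a b n i \<le> grid a b n (Suc i)" for i using grid_mono[OF ab] by simp
    have "(\<integral>\<^sup>+t. S n t \<partial>lborel) = (\<Sum>i<Suc n. ennreal (q n i) * ennreal ((b - a) / Suc n))"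
      unfolding S_def by (subst nn_integral_sum) (use le in \<open>auto simp: nn_integral_cmult_indicator grid_step simp del: of_nat_Suc\<close>)
    also have "\<dots> = (\<Sum>i<Suc n. ennreal (q n i * ((b - a) / Suc n)))"
      by (intro sum.cong refl ennreal_mult[symmetric] q0 less_imp_le[OF len])
    also have "\<dots> = ennreal (\<Sum>i<Suc n. q n i * ((b - a) / Suc n))"
      by (intro sum_ennreal mult_nonneg_nonneg q0 less_imp_le[OF len])
    also have "(\<Sum>i<Suc n. q n i * ((b - a) / Suc n))
        = (\<Sum>i<Suc n. ((b - a) / Suc n) powr (1 - p) * \<bar>f (grid a b n (Suc i)) - f (grid a b n i)\<bar> powr p)"
    proof (rule sum.cong[OF refl])
      fix i
      show "q n i * ((b - a) / Suc n) = ((b - a) / Suc n) powr (1 - p) * \<bar>f (grid a b n (Suc i)) - f (grid a b n i)\<bar> powr p"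
        unfolding q_def by (rule scale[OF len])
    qed
    also have "ennreal \<dots> \<le> ennreal C" by (intro ennreal_leI bound)
    finally show ?thesis .
  qed
  then have S_bound: "limsup (\<lambda>n. \<integral>\<^sup>+t. S n t \<partial>lborel) \<le> ennreal C"
    by (intro Limsup_bounded always_eventually allI)
  have S_meas: "S n \<in> borel_measurable lborel" for n unfolding S_def by measurable
  have "(\<integral>\<^sup>+t. liminf (\<lambda>n. S n t) \<partial>lborel) \<le> liminf (\<lambda>n. \<integral>\<^sup>+t. S n t \<partial>lborel)"
    by (rule nn_integral_liminf[OF S_meas])
  also have "\<dots> \<le> limsup (\<lambda>n. \<integral>\<^sup>+t. S n t \<partial>lborel)"
    by (rule Liminf_le_Limsup[OF sequentially_bot])
  also note S_bound
  finally have S_le: "(\<integral>\<^sup>+t. liminf (\<lambda>n. S n t) \<partial>lborel) \<le> ennreal C" .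
  have "AE t in lborel. ennreal (\<bar>g t\<bar> powr p) * indicator {a..b} t \<le> liminf (\<lambda>n. S n t)"
    using deriv AE_lborel_singleton[of a] AE_lborel_singleton[of b]
  proof eventually_elim
    case (elim t)
    show ?case
    proof (cases "a < t \<and> t < b")
      case False
      then show ?thesis using elim by (auto simp: indicator_def)
    next
      case True
      have "\<exists>i<Suc n. grid a b n i \<le> t \<and> t < grid a b n (Suc i)" for n
        using grid_cell[OF ab, of t n] True by (metis less_imp_le)
      then obtain i where i: "\<And>n. i n < Suc n" "\<And>n. grid a b n (i n) \<le> t" "\<And>n. t < grid a b n (Suc (i n))"
        by metis
      have lim0: "(\<lambda>n. (b - a) / Suc n) \<longlonglongrightarrow> 0"
        by (rule LIMSEQ_Suc[OF lim_const_over_n])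
      have u: "(\<lambda>n. grid a b n (i n)) \<longlonglongrightarrow> t"
      proof (rule tendsto_sandwich)
        show "(\<lambda>n. t - (b - a) / Suc n) \<longlonglongrightarrow> t" using tendsto_diff[OF tendsto_const lim0, of t] by simp
        show "\<forall>\<^sub>F n in sequentially. t - (b - a) / Suc n \<le> grid a b n (i n)"
          using i(3) grid_step[of a b _ "i _"] by (intro always_eventually allI) (smt (verit))
      qed (use i(2) in auto)
      have v: "(\<lambda>n. grid a b n (Suc (i n))) \<longlonglongrightarrow> t"
      proof (rule tendsto_sandwich[of "\<lambda>_. t" _ _ "\<lambda>n. t + (b - a) / Suc n"])
        show "(\<lambda>n. t + (b - a) / Suc n) \<longlonglongrightarrow> t" using tendsto_add[OF tendsto_const lim0, of t] by simp
        show "\<forall>\<^sub>F n in sequentially. grid a b n (Suc (i n)) \<le> t + (b - a) / Suc n"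
          using i(2) grid_step[of a b _ "i _"] by (intro always_eventually allI) (smt (verit))
      qed (simp_all add: less_imp_le[OF i(3)])
      have "(\<lambda>n. (f (grid a b n (Suc (i n))) - f (grid a b n (i n))) / (grid a b n (Suc (i n)) - grid a b n (i n))) \<longlonglongrightarrow> g t"
        by (rule straddle_derivative[OF _ u v i(2) less_imp_le[OF i(3)] le_less_trans[OF i(2,3)]])
          (use elim True in simp)
      then have "(\<lambda>n. q n (i n)) \<longlonglongrightarrow> \<bar>g t\<bar> powr p"
        unfolding q_def grid_step using p by (intro tendsto_intros) auto
      then have "(\<lambda>n. ennreal (q n (i n))) \<longlonglongrightarrow> ennreal (\<bar>g t\<bar> powr p)"
        by (intro tendsto_ennrealI)
      then have "ennreal (\<bar>g t\<bar> powr p) = liminf (\<lambda>n. ennreal (q n (i n)))"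
        by (intro lim_imp_Liminf[symmetric]) auto
      \<comment> \<open>The cell containing \<open>t\<close> contributes one of the summands of \<open>S n t\<close>.\<close>
      also have "\<dots> \<le> liminf (\<lambda>n. S n t)"
      proof (rule Liminf_mono, rule always_eventually, rule allI)
        fix n
        have "ennreal (q n (i n)) = ennreal (q n (i n)) * indicator {grid a b n (i n)..<grid a b n (Suc (i n))} t"
          using i by simp
        also have "\<dots> \<le> S n t" unfolding S_def
          by (rule member_le_sum[where f = "\<lambda>j. ennreal (q n j) * indicator {grid a b n j..<grid a b n (Suc j)} t"]) (use i(1) in auto)
        finally show "ennreal (q n (i n)) \<le> S n t" .
      qed
      finally show ?thesis using True by simp
    qed
  qed
  then show ?thesis using S_le by (rule order_trans[OF nn_integral_mono_AE])
qed

definition grid_increments :: "real \<Rightarrow> real \<Rightarrow> real \<Rightarrow> (real \<Rightarrow> 'a) \<Rightarrow> nat \<Rightarrow> ('a \<times> 'a \<times> real) list" where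
  "grid_increments p a b c n =
    map (\<lambda>i. (c (grid a b n (Suc i)), c (grid a b n i), ((b - a) / Suc n) powr (1 - p))) [0..<Suc n]"

lemma weighted_variation_grid:
  "weighted_variation p (grid_increments p a b c n) h
    = (\<Sum>i<Suc n. ((b - a) / Suc n) powr (1 - p) * \<bar>h (c (grid a b n (Suc i))) - h (c (grid a b n i))\<bar> powr p)"
  unfolding weighted_variation_def grid_increments_def
  by (simp add: sum_list_distinct_conv_sum_set atLeast0LessThan o_def del: upt_Suc of_nat_Suc sum.lessThan_Suc)

text \<open>
  By Jensen's inequality a summand is at most the integral of \<open>G\<^sup>p\<close> over its cell.
\<close>

lemma Lp_dominated_grid_bound:
  fixes f :: "real \<Rightarrow> real"
  assumes ab: "a < b" and p: "1 < p" and f: "Lp_dominated p {a..b} f"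
  obtains B where
    "\<And>n. (\<Sum>i<Suc n. ((b - a) / Suc n) powr (1 - p) * \<bar>f (grid a b n (Suc i)) - f (grid a b n i)\<bar> powr p) \<le> B"
proof -
  obtain G where G: "integrable lborel G" "integrable lborel (\<lambda>x. G x powr p)" "\<And>x. 0 \<le> G x"
    and fG: "\<And>s t. s \<in> {a..b} \<Longrightarrow> t \<in> {a..b} \<Longrightarrow> s \<le> t \<Longrightarrow> dist (f s) (f t) \<le> integral {s..t} G"
    using f unfolding Lp_dominated_def by blast
  let ?H = "\<lambda>x. G x powr p"
  have tele: "(\<Sum>i<m. integral {grid a b n i..grid a b n (Suc i)} ?H) = integral {a..grid a b n m} ?H" for n m
  proof (induction m)
    case (Suc m)
    have "a \<le> grid a b n m" using grid_mono[OF ab, of 0 m n] grid_ends(1)[of a b n] by simp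
    from integral_diff_Icc[OF G(2) this grid_mono[OF ab, of m "Suc m" n]]
    have "integral {a..grid a b n (Suc m)} ?H
        = integral {a..grid a b n m} ?H + integral {grid a b n m..grid a b n (Suc m)} ?H" by simp
    then show ?case by (simp only: sum.lessThan_Suc Suc.IH)
  qed (simp add: grid_ends)
  show thesis
  proof (rule that[of "integral {a..b} ?H"])
    fix n
    have "((b - a) / Suc n) powr (1 - p) * \<bar>f (grid a b n (Suc i)) - f (grid a b n i)\<bar> powr p
        \<le> integral {grid a b n i..grid a b n (Suc i)} ?H" if "i < Suc n" for i
    proof -
      have lt: "grid a b n i < grid a b n (Suc i)"
      proof -
        have "0 < (b - a) / Suc n" using ab by simp
        then show ?thesis using grid_step[of a b n i] by linarith
      qed
      have "grid a b n i \<in> {a..b}" "grid a b n (Suc i) \<in> {a..b}"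
        using grid_mono[OF ab, of 0 i n] grid_mono[OF ab, of i "Suc n" n]
          grid_mono[OF ab, of 0 "Suc i" n] grid_mono[OF ab, of "Suc i" "Suc n" n] grid_ends[of a b n] that by auto
      then show ?thesis
        using Lp_dominated_powr_increment[OF p G lt fG] lt unfolding grid_step
        by (simp add: dist_real_def abs_minus_commute del: of_nat_Suc)
    qed
    then have "(\<Sum>i<Suc n. ((b - a) / Suc n) powr (1 - p) * \<bar>f (grid a b n (Suc i)) - f (grid a b n i)\<bar> powr p)
        \<le> (\<Sum>i<Suc n. integral {grid a b n i..grid a b n (Suc i)} ?H)"
      by (intro sum_mono) (simp only: lessThan_iff)
    also have "\<dots> = integral {a..b} ?H" by (simp only: tele grid_ends)
    finally show "(\<Sum>i<Suc n. ((b - a) / Suc n) powr (1 - p) * \<bar>f (grid a b n (Suc i)) - f (grid a b n i)\<bar> powr p)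
        \<le> integral {a..b} ?H" .
  qed
qed

lemma Lp_dominated_derivative:
  fixes f :: "real \<Rightarrow> real"
  assumes ab: "a < b" and f: "Lp_dominated p {a..b} f"
  obtains g where "integrable lborel g"
    "\<And>s t. a \<le> s \<Longrightarrow> s \<le> t \<Longrightarrow> t \<le> b \<Longrightarrow> f t - f s = integral {s..t} g"
    "AE t in lborel. a < t \<longrightarrow> t < b \<longrightarrow> (f has_real_derivative g t) (at t)"
proof -
  obtain G where G: "integrable lborel G" "\<And>x. 0 \<le> G x"
    and fG: "\<And>s t. s \<in> {a..b} \<Longrightarrow> t \<in> {a..b} \<Longrightarrow> s \<le> t \<Longrightarrow> dist (f s) (f t) \<le> integral {s..t} G"
    using f unfolding Lp_dominated_def by blast
  have "\<bar>f t - f s\<bar> \<le> integral {s..t} G" if "a \<le> s" "s \<le> t" "t \<le> b" for s t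
    using fG[of s t] that by (simp add: dist_real_def abs_minus_commute)
  then obtain g where g: "integrable lborel g"
      "\<And>s t. a \<le> s \<Longrightarrow> s \<le> t \<Longrightarrow> t \<le> b \<Longrightarrow> f t - f s = integral {s..t} g"
    using dominated_increments_imp_indefinite_integral[OF ab G, of f] by blast
  then show thesis by (intro that indefinite_integral_has_derivative_AE) auto
qed

text \<open>
  The uniform boundedness principle applied to the increments over all equidistant partitions.
\<close>

lemma uniform_derivative_bound:
  fixes c :: "real \<Rightarrow> 'a::metric_space"
  assumes ab: "a < b" and p: "1 < p"
    and dom: "\<And>h::'a \<Rightarrow> real. (\<exists>C. C-lipschitz_on UNIV h) \<Longrightarrow> Lp_dominated p {a..b} (\<lambda>t. h (c t))"
  obtains C where "0 \<le> C"
    "\<And>h. 1-lipschitz_on UNIV h \<Longrightarrow> \<exists>g. integrable lborel g \<and>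
      (\<forall>s t. a \<le> s \<longrightarrow> s \<le> t \<longrightarrow> t \<le> b \<longrightarrow> h (c t) - h (c s) = integral {s..t} g) \<and>
      (AE t in lborel. a < t \<longrightarrow> t < b \<longrightarrow> ((\<lambda>t. h (c t)) has_real_derivative g t) (at t)) \<and>
      (\<integral>\<^sup>+t. ennreal (\<bar>g t\<bar> powr p) * indicator {a..b} t \<partial>lborel) \<le> ennreal C"
proof -
  define PP where "PP = range (grid_increments p a b c)"
  have "0 \<le> w" if "P \<in> PP" "(u, v, w) \<in> set P" for P u v w
    using that by (auto simp: PP_def grid_increments_def)
  moreover have "\<exists>B. \<forall>P\<in>PP. weighted_variation p P h \<le> B" if lip: "\<exists>C. C-lipschitz_on UNIV h" for h :: "'a \<Rightarrow> real"
  proof -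
    obtain B where "\<And>n. (\<Sum>i<Suc n. ((b - a) / Suc n) powr (1 - p) * \<bar>h (c (grid a b n (Suc i))) - h (c (grid a b n i))\<bar> powr p) \<le> B"
      using Lp_dominated_grid_bound[OF ab p dom[OF lip]] by blast
    then show ?thesis unfolding PP_def by (intro exI[of _ B]) (auto simp only: weighted_variation_grid)
  qed
  ultimately obtain C where C: "0 \<le> C"
      "\<And>P h. P \<in> PP \<Longrightarrow> 1-lipschitz_on UNIV h \<Longrightarrow> weighted_variation p P h \<le> C"
    using weighted_variation_uniform_bound[of p PP] p by (metis less_imp_le)
  show thesis
  proof (rule that[OF C(1)])
    fix h :: "'a \<Rightarrow> real" assume h: "1-lipschitz_on UNIV h"
    obtain g where g: "integrable lborel g"
      "\<And>s t. a \<le> s \<Longrightarrow> s \<le> t \<Longrightarrow> t \<le> b \<Longrightarrow> h (c t) - h (c s) = integral {s..t} g"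
      "AE t in lborel. a < t \<longrightarrow> t < b \<longrightarrow> ((\<lambda>t. h (c t)) has_real_derivative g t) (at t)"
      using Lp_dominated_derivative[OF ab dom] h by blast
    have "(\<integral>\<^sup>+t. ennreal (\<bar>g t\<bar> powr p) * indicator {a..b} t \<partial>lborel) \<le> ennreal C"
    proof (rule derivative_powr_integral_le[OF ab p _ g(3)])
      show "g \<in> borel_measurable borel" using g(1) by auto
      show "(\<Sum>i<Suc n. ((b - a) / Suc n) powr (1 - p) * \<bar>h (c (grid a b n (Suc i))) - h (c (grid a b n i))\<bar> powr p) \<le> C" for n
        using C(2)[OF _ h, of "grid_increments p a b c n"] unfolding PP_def weighted_variation_grid by blast
    qed
    then show "\<exists>g. integrable lborel g \<and>
      (\<forall>s t. a \<le> s \<longrightarrow> s \<le> t \<longrightarrow> t \<le> b \<longrightarrow> h (c t) - h (c s) = integral {s..t} g) \<and>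
      (AE t in lborel. a < t \<longrightarrow> t < b \<longrightarrow> ((\<lambda>t. h (c t)) has_real_derivative g t) (at t)) \<and>
      (\<integral>\<^sup>+t. ennreal (\<bar>g t\<bar> powr p) * indicator {a..b} t \<partial>lborel) \<le> ennreal C"
      using g by blast
  qed
qed

section \<open>Crossings of a curve with itself\<close>

text \<open>
  An isolated point is determined by a basic open set that meets \<open>S\<close> only there.
\<close>

lemma countable_non_limit_points:
  fixes S :: "'a::second_countable_topology set"
  shows "countable {x\<in>S. \<not> x islimpt S}"
proof -
  obtain B :: "'a set set" where B: "countable B" "topological_basis B"
    using ex_countable_basis by blast
  have "\<exists>U\<in>B. U \<inter> S = {x}" if x: "x \<in> S" "\<not> x islimpt S" for x
  proof -
    obtain T where T: "x \<in> T" "open T" "\<And>y. y \<in> S \<Longrightarrow> y \<in> T \<Longrightarrow> y = x"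
      using x(2) unfolding islimpt_def by blast
    obtain U where "U \<in> B" "x \<in> U" "U \<subseteq> T"
      using topological_basisE[OF B(2) T(2,1)] by blast
    then show ?thesis using T(3) x(1) by blast
  qed
  then obtain U where U: "\<And>x. x \<in> S \<Longrightarrow> \<not> x islimpt S \<Longrightarrow> U x \<in> B \<and> U x \<inter> S = {x}"
    by metis
  have "inj_on U {x\<in>S. \<not> x islimpt S}"
    by (rule inj_onI) (metis (no_types, lifting) U mem_Collect_eq singleton_inject)
  moreover have "countable (U ` {x\<in>S. \<not> x islimpt S})"
    using U by (intro countable_subset[OF _ B(1)]) auto
  ultimately show ?thesis by (rule countable_image_inj_on[rotated])
qed

lemma has_derivative_seq_quotient:
  fixes f :: "real \<Rightarrow> real"
  assumes "(f has_real_derivative D) (at t)" "u \<longlonglongrightarrow> t" "\<forall>\<^sub>F i in sequentially. u i \<noteq> t"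
  shows "(\<lambda>i. (f (u i) - f t) / (u i - t)) \<longlonglongrightarrow> D"
proof -
  have "filterlim u (at t) sequentially" using assms(2,3) by (simp add: filterlim_at)
  then show ?thesis
    using assms(1) unfolding has_field_derivative_iff by (rule filterlim_compose[rotated])
qed

lemma nonzero_derivative_seq_neq:
  fixes f :: "real \<Rightarrow> real"
  assumes "(f has_real_derivative D) (at t)" "D \<noteq> 0" "u \<longlonglongrightarrow> t" "\<forall>\<^sub>F i in sequentially. u i \<noteq> t"
  shows "\<forall>\<^sub>F i in sequentially. f (u i) \<noteq> f t"
proof -
  have "\<forall>\<^sub>F i in sequentially. (f (u i) - f t) / (u i - t) \<noteq> 0"
    using has_derivative_seq_quotient[OF assms(1,3,4)] assms(2) by (rule tendsto_imp_eventually_ne)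
  then show ?thesis by eventually_elim auto
qed

text \<open>
  Times of two passages of the planar curve \<open>(f, g)\<close> through a common point. At such a pair \<open>s\<close>, \<open>t\<close>, assume
  that \<open>s\<close> is a limit of further times \<open>u i\<close> with partners \<open>v i\<close>. If the partners converge to \<open>t\<close>, then the quotients of
  the increments of \<open>g\<close> and \<open>f\<close> agree along both sequences, and in the limit \<open>g' s * f' t = f' s * g' t\<close>;
  this contradicts the assumptions on \<open>A\<close> and \<open>B\<close>. To make the partners converge, \<open>B\<close> is cut into countably many pieces
  on which \<open>g\<close> is injective with a Lipschitz inverse, as is possible since \<open>g'\<close> does not vanish on \<open>B\<close>. The
  times \<open>s\<close> with a partner in one fixed piece are then isolated among each other, hence countably many.
\<close>

lemma countable_crossings:
  fixes f g f' g' :: "real \<Rightarrow> real"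
  assumes f: "\<And>s. s \<in> A \<union> B \<Longrightarrow> (f has_real_derivative f' s) (at s)"
    and g: "\<And>s. s \<in> A \<union> B \<Longrightarrow> (g has_real_derivative g' s) (at s)"
    and A: "\<And>s. s \<in> A \<Longrightarrow> f' s \<noteq> 0 \<and> \<bar>g' s\<bar> \<le> \<bar>f' s\<bar>"
    and B: "\<And>t. t \<in> B \<Longrightarrow> \<bar>f' t\<bar> < \<bar>g' t\<bar>"
  shows "countable {s\<in>A. \<exists>t\<in>B. f s = f t \<and> g s = g t}"
proof -
  \<comment> \<open>The second index restricts the piece to a half-open interval of length \<open>1 / Suc k\<close>, so that the lower bound
    for the increments of \<open>g\<close> holds between any two of its points.\<close>
  define Bk where "Bk = (\<lambda>(k::nat, j::int). {t::real. t \<in> B \<and> (\<forall>u. \<bar>u - t\<bar> < 1 / Suc k \<longrightarrow> \<bar>u - t\<bar> \<le> Suc k * \<bar>g u - g t\<bar>) \<and> \<lfloor>t * real (Suc k)\<rfloor> = j})"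
  define Z where "Z = (\<lambda>kj. {s\<in>A. \<exists>t\<in>Bk kj. f s = f t \<and> g s = g t})"
  have cover: "\<exists>kj. t \<in> Bk kj" if t: "t \<in> B" for t :: real
  proof -
    have g't: "0 < \<bar>g' t\<bar>" using B[OF t] by linarith
    have "((\<lambda>y. \<bar>(g y - g t) / (y - t)\<bar>) \<longlongrightarrow> \<bar>g' t\<bar>) (at t)"
      using g[of t] t by (intro tendsto_rabs) (auto simp: has_field_derivative_iff)
    then have "\<forall>\<^sub>F y in at t. \<bar>g' t\<bar> / 2 < \<bar>(g y - g t) / (y - t)\<bar>"
      by (rule order_tendstoD) (use g't in simp)
    then obtain d where d: "d > 0" "\<And>y. y \<noteq> t \<Longrightarrow> \<bar>y - t\<bar> < d \<Longrightarrow> \<bar>g' t\<bar> / 2 < \<bar>(g y - g t) / (y - t)\<bar>"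
      unfolding eventually_at by (auto simp: dist_real_def)
    obtain k :: nat where k: "1 / Suc k < d" "1 / Suc k < \<bar>g' t\<bar> / 2"
      using nat_approx_posE[of "min d (\<bar>g' t\<bar> / 2)"] d g't by auto
    have "\<bar>u - t\<bar> \<le> Suc k * \<bar>g u - g t\<bar>" if u: "\<bar>u - t\<bar> < 1 / Suc k" for u
    proof (cases "u = t")
      case False
      then have "1 / Suc k < \<bar>g u - g t\<bar> / \<bar>u - t\<bar>"
        using d(2)[OF False] u k unfolding abs_divide by linarith
      then show ?thesis using False by (simp add: field_simps)
    qed simp
    then show ?thesis using t by (intro exI[of _ "(k, \<lfloor>t * real (Suc k)\<rfloor>)"]) (simp add: Bk_def)
  qed
  have isolated: "\<not> s islimpt Z kj" if s: "s \<in> Z kj" for s kj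
  proof
    assume "s islimpt Z kj"
    then obtain u where u: "\<And>i. u i \<in> Z kj - {s}" "u \<longlonglongrightarrow> s"
      unfolding islimpt_sequential by auto
    obtain k j where kj: "kj = (k, j)" by (cases kj)
    obtain t where t: "t \<in> Bk kj" "f s = f t" "g s = g t" using s by (auto simp: Z_def)
    have "\<exists>v. v \<in> Bk kj \<and> f (u i) = f v \<and> g (u i) = g v" for i using u(1)[of i] by (auto simp: Z_def)
    then obtain v where v: "\<And>i. v i \<in> Bk kj" "\<And>i. f (u i) = f (v i)" "\<And>i. g (u i) = g (v i)" by metis
    have sA: "s \<in> A" and tB: "t \<in> B" using s t by (auto simp: Z_def Bk_def kj)
    have ds: "(f has_real_derivative f' s) (at s)" "(g has_real_derivative g' s) (at s)"
      "(f has_real_derivative f' t) (at t)" "(g has_real_derivative g' t) (at t)"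
      using f g sA tB by auto
    have une: "\<forall>\<^sub>F i in sequentially. u i \<noteq> s" using u(1) by auto
    have "\<bar>v i - t\<bar> \<le> Suc k * \<bar>g (u i) - g s\<bar>" for i
    proof -
      have "\<lfloor>v i * Suc k\<rfloor> = \<lfloor>t * real (Suc k)\<rfloor>" using v(1)[of i] t(1) by (simp add: Bk_def kj)
      then have "\<bar>v i * Suc k - t * Suc k\<bar> < 1" by linarith
      then have "\<bar>v i - t\<bar> * Suc k < 1" by (simp add: abs_mult flip: left_diff_distrib)
      then have "\<bar>v i - t\<bar> < 1 / Suc k" by (simp add: field_simps)
      then show ?thesis using t v by (auto simp: Bk_def kj)
    qed
    then have "\<forall>\<^sub>F i in sequentially. \<bar>v i - t\<bar> \<le> Suc k * \<bar>g (u i) - g s\<bar>" by simp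
    moreover have "(\<lambda>i. Suc k * \<bar>g (u i) - g s\<bar>) \<longlonglongrightarrow> Suc k * \<bar>g s - g s\<bar>"
      using isCont_tendsto_compose[OF DERIV_isCont[OF ds(2)] u(2)] by (intro tendsto_intros)
    ultimately have "(\<lambda>i. \<bar>v i - t\<bar>) \<longlonglongrightarrow> 0"
      by (auto intro: tendsto_sandwich[of "\<lambda>_. 0" _ _ "\<lambda>i. Suc k * \<bar>g (u i) - g s\<bar>"] simp del: of_nat_Suc)
    then have vt: "v \<longlonglongrightarrow> t" by (simp only: tendsto_rabs_zero_iff LIM_zero_iff)
    have fne: "\<forall>\<^sub>F i in sequentially. f (u i) \<noteq> f s"
      using A[OF sA] by (intro nonzero_derivative_seq_neq[OF ds(1) _ u(2) une]) simp
    then have vne: "\<forall>\<^sub>F i in sequentially. v i \<noteq> t"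
      by eventually_elim (use v t in metis)
    have g't: "g' t \<noteq> 0" using B[OF tB] by linarith
    have gne: "\<forall>\<^sub>F i in sequentially. g (v i) \<noteq> g t"
      by (intro nonzero_derivative_seq_neq[OF ds(4) _ vt vne] g't)
    have "(\<lambda>i. ((g (u i) - g s) / (u i - s)) / ((f (u i) - f s) / (u i - s))
             * (((f (v i) - f t) / (v i - t)) / ((g (v i) - g t) / (v i - t))))
          \<longlonglongrightarrow> (g' s / f' s) * (f' t / g' t)"
      using A[OF sA] g't
      by (intro tendsto_mult tendsto_divide has_derivative_seq_quotient[OF ds(1) u(2) une]
          has_derivative_seq_quotient[OF ds(2) u(2) une] has_derivative_seq_quotient[OF ds(3) vt vne]
          has_derivative_seq_quotient[OF ds(4) vt vne]) simp_all
    moreover have "\<forall>\<^sub>F i in sequentially. ((g (u i) - g s) / (u i - s)) / ((f (u i) - f s) / (u i - s))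
             * (((f (v i) - f t) / (v i - t)) / ((g (v i) - g t) / (v i - t))) = 1"
      using fne vne gne une
    proof eventually_elim
      case (elim i)
      have alg: "(E / h) / (D / h) * ((D / k) / (E / k)) = 1" if "E \<noteq> 0" "D \<noteq> 0" "h \<noteq> 0" "k \<noteq> 0"
        for D E h k :: real using that by simp
      show ?case
        unfolding v(2,3) t(2,3) by (rule alg) (use elim v(2)[of i] t(2) in auto)
    qed
    ultimately have "(g' s / f' s) * (f' t / g' t) = 1"
      by (rule LIMSEQ_unique[OF _ tendsto_eventually])
    then have "g' s * f' t = f' s * g' t"
      using A[OF sA] g't by (simp add: nonzero_eq_divide_eq)
    then have "\<bar>g' s\<bar> * \<bar>f' t\<bar> = \<bar>f' s\<bar> * \<bar>g' t\<bar>"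
      by (simp only: abs_mult[symmetric])
    moreover have "\<bar>g' s\<bar> * \<bar>f' t\<bar> \<le> \<bar>f' s\<bar> * \<bar>f' t\<bar>" using A[OF sA] by (simp add: mult_right_mono)
    moreover have "\<bar>f' s\<bar> * \<bar>f' t\<bar> < \<bar>f' s\<bar> * \<bar>g' t\<bar>" using A[OF sA] B[OF tB] by simp
    ultimately show False by linarith
  qed
  have "countable (Z kj)" for kj
    using countable_non_limit_points[of "Z kj"] isolated[of _ kj]
    by (metis (mono_tags, lifting) Collect_cong Collect_mem_eq)
  then have "countable (\<Union>kj. Z kj)" by blast
  moreover have "{s\<in>A. \<exists>t\<in>B. f s = f t \<and> g s = g t} \<subseteq> (\<Union>kj. Z kj)"
    using cover by (fastforce simp: Z_def)
  ultimately show ?thesis by (rule countable_subset[rotated])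
qed

section \<open>Oscillating Lipschitz functions\<close>

text \<open>
  McShane's extension: the largest extension with the same Lipschitz constant is an infimum of cones.
\<close>

lemma lipschitz_real_extension:
  fixes f :: "'a::metric_space \<Rightarrow> real"
  assumes "1-lipschitz_on S f"
  obtains h where "1-lipschitz_on UNIV h" "\<And>x. x \<in> S \<Longrightarrow> h x = f x"
proof (cases "S = {}")
  case True
  then show ?thesis using that[of "\<lambda>_. 0"] by (simp add: lipschitz_on_def)
next
  case False
  define h where "h = (\<lambda>x. INF y\<in>S. f y + dist x y)"
  have lip: "f z \<le> f y + dist z y" if "z \<in> S" "y \<in> S" for z y
    using lipschitz_onD[OF assms that] by (simp add: dist_real_def)
  obtain z where z: "z \<in> S" using False by blast
  have bdd: "bdd_below ((\<lambda>y. f y + dist x y) ` S)" for x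
  proof (rule bdd_belowI2)
    fix y assume "y \<in> S"
    then show "f z - dist x z \<le> f y + dist x y"
      using lip[OF z] dist_triangle[of z y x] by (force simp: dist_commute)
  qed
  have "h x \<le> h x' + dist x x'" for x x'
  proof -
    have "h x - dist x x' \<le> f y + dist x' y" if "y \<in> S" for y
      using cINF_lower[OF bdd[of x] that] dist_triangle[of x y x'] unfolding h_def by simp
    then have "h x - dist x x' \<le> (INF y\<in>S. f y + dist x' y)" by (intro cINF_greatest False)
    then have "h x - dist x x' \<le> h x'" by (simp add: h_def)
    then show ?thesis by simp
  qed
  then have "h x - h x' \<le> dist x x'" "h x' - h x \<le> dist x x'" for x x'
    by (simp_all add: algebra_simps) (metis add.commute dist_commute)
  then have "1-lipschitz_on UNIV h"
    by (intro lipschitz_onI) (auto simp: dist_real_def abs_le_iff)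
  moreover have "h x = f x" if "x \<in> S" for x
  proof (rule antisym)
    show "h x \<le> f x" using cINF_lower[OF bdd[of x] that] by (simp add: h_def)
    show "f x \<le> h x" unfolding h_def using lip[OF that] by (intro cINF_greatest False)
  qed
  ultimately show ?thesis by (rule that)
qed

text \<open>
  The separation of the compact sets is at least \<open>2 \<delta>\<close>, whereas the prescribed values lie
  between \<open>-\<delta>\<close> and \<open>\<delta>\<close>. So the Lipschitz condition holds between points of different sets, and on each
  set it holds because rescaling \<open>\<phi>\<close> in both variables preserves the Lipschitz constant. The
  same \<open>\<delta>\<close> serves every \<open>\<phi>\<close>, since the sine and the cosine are to be used together.
\<close>

lemma separated_oscillations:
  fixes K :: "nat \<Rightarrow> 'a::metric_space set" and d :: "nat \<Rightarrow> 'a \<Rightarrow> real"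
  assumes K: "\<And>n. n < N \<Longrightarrow> compact (K n)"
    and disj: "\<And>m n. m < N \<Longrightarrow> n < N \<Longrightarrow> m \<noteq> n \<Longrightarrow> K m \<inter> K n = {}"
    and d: "\<And>n. n < N \<Longrightarrow> 1-lipschitz_on UNIV (d n)"
  obtains \<delta> where "0 < \<delta>"
    "\<And>\<phi>. 1-lipschitz_on UNIV \<phi> \<Longrightarrow> (\<And>x. \<bar>\<phi> x\<bar> \<le> 1) \<Longrightarrow>
      \<exists>h. 1-lipschitz_on UNIV h \<and> (\<forall>n<N. \<forall>y\<in>K n. h y = \<delta> * \<phi> (d n y / \<delta>))"
proof -
  have "\<exists>e>0. \<forall>x\<in>K m. \<forall>y\<in>K n. e \<le> dist x y" if mn: "m < N" "n < N" "m \<noteq> n" for m n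
  proof (cases "K m = {} \<or> K n = {}")
    case True
    then show ?thesis by (intro exI[of _ 1]) auto
  next
    case False
    have "continuous_on (K m) (\<lambda>x. infdist x (K n))"
      by (intro continuous_on_infdist continuous_on_id)
    then obtain z where z: "z \<in> K m" "\<And>x. x \<in> K m \<Longrightarrow> infdist z (K n) \<le> infdist x (K n)"
      using continuous_attains_inf[OF K[OF mn(1)], of "\<lambda>x. infdist x (K n)"] False by blast
    have "z \<notin> K n" using z(1) disj[OF mn] by blast
    then have "0 < infdist z (K n)"
      using in_closed_iff_infdist_zero[OF compact_imp_closed[OF K[OF mn(2)]]] False
      by (metis infdist_nonneg less_le)
    moreover have "infdist z (K n) \<le> dist x y" if "x \<in> K m" "y \<in> K n" for x y
      using z(2)[OF that(1)] infdist_le[OF that(2), of x] by simp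
    ultimately show ?thesis by blast
  qed
  then obtain e where e: "\<And>m n. m < N \<Longrightarrow> n < N \<Longrightarrow> m \<noteq> n \<Longrightarrow> 0 < e m n"
    "\<And>m n x y. m < N \<Longrightarrow> n < N \<Longrightarrow> m \<noteq> n \<Longrightarrow> x \<in> K m \<Longrightarrow> y \<in> K n \<Longrightarrow> e m n \<le> dist x y"
    by metis
  define E where "E = insert 1 ((\<lambda>(m, n). e m n) ` {(m, n). m < N \<and> n < N \<and> m \<noteq> n})"
  have "finite {(m, n). m < N \<and> n < N \<and> m \<noteq> n}"
    by (rule finite_subset[of _ "{..<N} \<times> {..<N}"]) auto
  then have "finite E" by (simp add: E_def)
  define \<delta> where "\<delta> = Min E / 2"
  have "0 < Min E" using \<open>finite E\<close> e(1) by (subst Min_gr_iff) (auto simp: E_def)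
  then have \<delta>pos: "0 < \<delta>" by (simp add: \<delta>_def)
  have \<delta>: "2 * \<delta> \<le> dist x y" if "m < N" "n < N" "m \<noteq> n" "x \<in> K m" "y \<in> K n" for m n x y
  proof -
    have "2 * \<delta> \<le> e m n" unfolding \<delta>_def using \<open>finite E\<close> that by (auto intro!: Min_le simp: E_def)
    then show ?thesis using e(2)[OF that] by simp
  qed
  show thesis
  proof (rule that[OF \<delta>pos])
    fix \<phi> :: "real \<Rightarrow> real"
    assume \<phi>: "1-lipschitz_on UNIV \<phi>" "\<And>x. \<bar>\<phi> x\<bar> \<le> 1"
    define f where "f = (\<lambda>y. \<delta> * \<phi> (d (SOME n. n < N \<and> y \<in> K n) y / \<delta>))"
    have f: "f y = \<delta> * \<phi> (d n y / \<delta>)" if "n < N" "y \<in> K n" for n y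
    proof -
      have "(SOME n. n < N \<and> y \<in> K n) = n"
        using that disj by (intro some_equality) blast+
      then show ?thesis by (simp add: f_def)
    qed
    have "1-lipschitz_on (\<Union>n<N. K n) f"
    proof (rule lipschitz_onI)
      fix x y assume "x \<in> (\<Union>n<N. K n)" "y \<in> (\<Union>n<N. K n)"
      then obtain m n where mn: "m < N" "n < N" "x \<in> K m" "y \<in> K n" by blast
      show "dist (f x) (f y) \<le> 1 * dist x y"
      proof (cases "m = n")
        case True
        have "\<bar>\<phi> (d n x / \<delta>) - \<phi> (d n y / \<delta>)\<bar> \<le> \<bar>d n x / \<delta> - d n y / \<delta>\<bar>"
          using lipschitz_onD[OF \<phi>(1), of "d n x / \<delta>" "d n y / \<delta>"] by (simp add: dist_real_def)
        also have "\<dots> = \<bar>d n x - d n y\<bar> / \<delta>" using \<delta>pos by (simp flip: diff_divide_distrib)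
        also have "\<dots> \<le> dist x y / \<delta>"
          using lipschitz_onD[OF d[OF mn(2)], of x y] \<delta>pos by (intro divide_right_mono) (auto simp: dist_real_def)
        finally have "\<delta> * \<bar>\<phi> (d n x / \<delta>) - \<phi> (d n y / \<delta>)\<bar> \<le> dist x y"
          using \<delta>pos by (simp add: pos_le_divide_eq mult.commute)
        moreover have "f x - f y = \<delta> * (\<phi> (d n x / \<delta>) - \<phi> (d n y / \<delta>))"
          using f[OF mn(2,4)] f[OF mn(1,3)] True by (simp add: right_diff_distrib)
        ultimately show ?thesis using \<delta>pos by (simp add: dist_real_def abs_mult)
      next
        case False
        have "\<bar>f x\<bar> \<le> \<delta>" "\<bar>f y\<bar> \<le> \<delta>"
          using f[OF mn(2,4)] f[OF mn(1,3)] \<phi>(2) \<delta>pos by (auto simp: abs_mult mult_left_le)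
        then show ?thesis using \<delta>[OF mn(1,2) False mn(3,4)] by (simp add: dist_real_def)
      qed
    qed simp
    then obtain h where "1-lipschitz_on UNIV h" "\<And>x. x \<in> (\<Union>n<N. K n) \<Longrightarrow> h x = f x"
      by (rule lipschitz_real_extension) blast
    then show "\<exists>h. 1-lipschitz_on UNIV h \<and> (\<forall>n<N. \<forall>y\<in>K n. h y = \<delta> * \<phi> (d n y / \<delta>))"
      using f by (intro exI[of _ h]) (metis UN_I lessThan_iff)
  qed
qed

lemma lipschitz_sin: "1-lipschitz_on UNIV (sin :: real \<Rightarrow> real)"
proof (rule lipschitz_onI)
  fix x y :: real
  have "\<bar>sin x - sin y\<bar> = 2 * \<bar>sin ((x - y) / 2)\<bar> * \<bar>cos ((x + y) / 2)\<bar>"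
    by (simp add: sin_diff_sin abs_mult)
  also have "\<dots> \<le> 2 * \<bar>(x - y) / 2\<bar> * 1"
    by (intro mult_mono abs_sin_x_le_abs_x) auto
  finally show "dist (sin x) (sin y) \<le> 1 * dist x y" by (simp add: dist_real_def)
qed simp

lemma lipschitz_cos: "1-lipschitz_on UNIV (cos :: real \<Rightarrow> real)"
proof (rule lipschitz_onI)
  fix x y :: real
  have "dist (cos x) (cos y) = dist (sin (pi / 2 - x)) (sin (pi / 2 - y))"
    by (simp add: sin_cos_eq)
  also have "\<dots> \<le> 1 * dist (pi / 2 - x) (pi / 2 - y)"
    by (rule lipschitz_onD[OF lipschitz_sin]) auto
  finally show "dist (cos x) (cos y) \<le> 1 * dist x y" by (simp add: dist_real_def abs_minus_commute)
qed simp

text \<open>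
  Derivatives at a limit point of \<open>K\<close> are determined by the values on \<open>K\<close>. So
  \<open>g1 = cos \<theta> * g\<close> and \<open>g2 = - sin \<theta> * g\<close> with the same angle, which makes \<open>g = cos \<theta> * g1 - sin \<theta> * g2\<close>.
\<close>

lemma oscillation_derivative_bound:
  fixes c :: "real \<Rightarrow> 'a" and d h1 h2 :: "'a \<Rightarrow> real"
  assumes lim: "t islimpt K" "t \<in> K" and \<delta>: "0 < \<delta>" and p: "0 \<le> p"
    and h: "\<And>s. s \<in> K \<Longrightarrow> h1 (c s) = \<delta> * sin (d (c s) / \<delta>)" "\<And>s. s \<in> K \<Longrightarrow> h2 (c s) = \<delta> * cos (d (c s) / \<delta>)"
    and dg: "((\<lambda>s. d (c s)) has_real_derivative g) (at t)"
    and dg1: "((\<lambda>s. h1 (c s)) has_real_derivative g1) (at t)"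
    and dg2: "((\<lambda>s. h2 (c s)) has_real_derivative g2) (at t)"
  shows "\<bar>g\<bar> powr p \<le> 2 powr p * (\<bar>g1\<bar> powr p + \<bar>g2\<bar> powr p)"
proof -
  have nb: "at t within K \<noteq> bot" using lim(1) by (simp add: trivial_limit_within)
  let ?x = "d (c t) / \<delta>"
  have "((\<lambda>s. \<delta> * sin (d (c s) / \<delta>)) has_real_derivative cos ?x * g) (at t)"
    using dg \<delta> by (auto intro!: derivative_eq_intros)
  from has_field_derivative_transform_within[OF has_field_derivative_at_within[OF this] zero_less_one lim(2) h(1)[symmetric]]
  have e1: "g1 = cos ?x * g"
    using has_field_derivative_unique[OF has_field_derivative_at_within[OF dg1] _ nb] by blast
  have "((\<lambda>s. \<delta> * cos (d (c s) / \<delta>)) has_real_derivative - sin ?x * g) (at t)"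
    using dg \<delta> by (auto intro!: derivative_eq_intros)
  from has_field_derivative_transform_within[OF has_field_derivative_at_within[OF this] zero_less_one lim(2) h(2)[symmetric]]
  have e2: "g2 = - sin ?x * g"
    using has_field_derivative_unique[OF has_field_derivative_at_within[OF dg2] _ nb] by blast
  have "cos ?x * cos ?x + sin ?x * sin ?x = 1" by simp
  then have "g = cos ?x * g1 - sin ?x * g2" unfolding e1 e2 by algebra
  then have "\<bar>g\<bar> \<le> \<bar>cos ?x\<bar> * \<bar>g1\<bar> + \<bar>sin ?x\<bar> * \<bar>g2\<bar>"
    by (metis abs_mult abs_triangle_ineq4)
  also have "\<dots> \<le> 1 * \<bar>g1\<bar> + 1 * \<bar>g2\<bar>" by (intro add_mono mult_right_mono) auto
  finally have "\<bar>g\<bar> powr p \<le> \<bar>\<bar>g1\<bar> + \<bar>g2\<bar>\<bar> powr p" using p by (intro powr_mono2) auto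
  also have "\<dots> \<le> 2 powr p * (\<bar>g1\<bar> powr p + \<bar>g2\<bar> powr p)"
    using powr_abs_add_le[OF p, of "\<bar>g1\<bar>" "\<bar>g2\<bar>"] by simp
  finally show ?thesis .
qed

section \<open>The largest of several derivatives\<close>

lemma inner_regular_approx:
  fixes M :: "'a::{second_countable_topology, complete_space} measure"
  assumes M: "sets M = sets borel" "emeasure M (space M) \<noteq> \<infinity>" and B: "B \<in> sets borel" and e: "(0::real) < e"
  obtains K where "compact K" "K \<subseteq> B" "emeasure M B \<le> emeasure M K + ennreal e"
proof (cases "emeasure M B = 0")
  case True
  then show thesis by (intro that[of "{}"]) auto
next
  case False
  have "emeasure M B \<le> emeasure M (space M)"
    using B M(1) by (intro emeasure_space)
  then have "emeasure M B < top" using M(2) by (metis infinity_ennreal_def less_top order_le_less_trans)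
  then have "emeasure M B - ennreal e < emeasure M B"
    using False e by (intro ennreal_between) (auto simp: zero_less_iff_neq_zero)
  also have "emeasure M B = (SUP K\<in>{K. K \<subseteq> B \<and> compact K}. emeasure M K)"
    by (rule inner_regular[OF M B])
  finally obtain K where K: "K \<subseteq> B" "compact K" "emeasure M B - ennreal e < emeasure M K"
    by (auto simp: less_SUP_iff)
  then have "emeasure M B \<le> emeasure M K + ennreal e"
    by (metis add.commute ennreal_minus_le_iff less_imp_le)
  then show thesis using K that by blast
qed

text \<open>
  A bound that does not depend on \<open>N\<close>. In \<open>A n\<close> the index \<open>n\<close> is the first one at
  which the maximum of the derivatives is attained, so that for \<open>n < k\<close> the
  derivatives compare weakly on \<open>A n\<close> and strictly on \<open>A k\<close>, as \<open>countable_crossings\<close> requires. The exceptional times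
  \<open>Z\<close> are countable, and the images under \<open>c\<close> of compact parts of the sets \<open>A n - Z\<close>
  are disjoint. The Lipschitz functions \<open>h1\<close> and \<open>h2\<close> that oscillate on these images satisfy the assumed
  bound and recover the maximum.
\<close>

lemma max_derivative_integral_le:
  fixes c :: "real \<Rightarrow> 'a::metric_space" and d :: "nat \<Rightarrow> 'a \<Rightarrow> real" and g :: "nat \<Rightarrow> real \<Rightarrow> real"
  assumes p: "0 \<le> p" and C: "0 \<le> C" and cont: "continuous_on {a..b} c"
    and D: "\<And>h. 1-lipschitz_on UNIV h \<Longrightarrow> \<exists>g\<in>borel_measurable borel.
      (AE t in lborel. a < t \<longrightarrow> t < b \<longrightarrow> ((\<lambda>t. h (c t)) has_real_derivative g t) (at t)) \<and>
      (\<integral>\<^sup>+t. ennreal (\<bar>g t\<bar> powr p) * indicator {a..b} t \<partial>lborel) \<le> ennreal C"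
    and d: "\<And>n. 1-lipschitz_on UNIV (d n)"
    and g[measurable]: "\<And>n. g n \<in> borel_measurable borel"
    and dg: "\<And>n. AE t in lborel. a < t \<longrightarrow> t < b \<longrightarrow> ((\<lambda>t. d n (c t)) has_real_derivative g n t) (at t)"
    and gC: "\<And>n. (\<integral>\<^sup>+t. ennreal (\<bar>g n t\<bar> powr p) * indicator {a..b} t \<partial>lborel) \<le> ennreal C"
  shows "(\<integral>\<^sup>+t. (SUP n\<in>{..<N}. ennreal (\<bar>g n t\<bar> powr p)) * indicator {a..b} t \<partial>lborel) \<le> ennreal (2 powr p * (2 * C))"
proof -
  define M where "M = (\<lambda>t. SUP n\<in>{..<N}. ennreal (\<bar>g n t\<bar> powr p))"
  have M_meas[measurable]: "M \<in> borel_measurable borel" unfolding M_def by measurable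
  have "AE t in lborel. \<forall>n. a < t \<longrightarrow> t < b \<longrightarrow> ((\<lambda>t. d n (c t)) has_real_derivative g n t) (at t)"
    unfolding AE_all_countable using dg by blast
  then obtain N0 where N0': "N0 \<in> null_sets lborel"
    "\<And>t. t \<in> space lborel - N0 \<Longrightarrow> \<forall>n. a < t \<longrightarrow> t < b \<longrightarrow> ((\<lambda>t. d n (c t)) has_real_derivative g n t) (at t)"
    by (rule AE_E3) blast
  have N0: "N0 \<in> null_sets lborel"
    "\<And>t n. t \<notin> N0 \<Longrightarrow> a < t \<Longrightarrow> t < b \<Longrightarrow> ((\<lambda>t. d n (c t)) has_real_derivative g n t) (at t)"
    using N0' by (simp_all only: Diff_iff space_lborel space_borel UNIV_I simp_thms)
  have [measurable]: "N0 \<in> sets borel" using N0(1) by auto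
  define A where "A = (\<lambda>n. {t\<in>space borel. a < t \<and> t < b \<and> t \<notin> N0 \<and> g n t \<noteq> 0 \<and>
      (\<forall>k\<in>{..<N}. \<bar>g k t\<bar> \<le> \<bar>g n t\<bar>) \<and> (\<forall>k\<in>{..<n}. \<bar>g k t\<bar> < \<bar>g n t\<bar>)})"
  have A_meas[measurable]: "A n \<in> sets borel" for n unfolding A_def by measurable
  have AD: "a < t" "t < b" "t \<notin> N0" "g n t \<noteq> 0" "\<And>k. k < N \<Longrightarrow> \<bar>g k t\<bar> \<le> \<bar>g n t\<bar>"
    "\<And>k. k < n \<Longrightarrow> \<bar>g k t\<bar> < \<bar>g n t\<bar>" if "t \<in> A n" for t n
    using that unfolding A_def by blast+
  have A_deriv: "((\<lambda>t. d k (c t)) has_real_derivative g k t) (at t)" if "t \<in> A n" for t n k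
    using AD(1-3)[OF that] by (intro N0(2))
  define Z where "Z = (\<Union>n. \<Union>k\<in>{k. n < k \<and> k < N}. {s\<in>A n. \<exists>t\<in>A k. d n (c s) = d n (c t) \<and> d k (c s) = d k (c t)})"
  have "countable {s\<in>A n. \<exists>t\<in>A k. d n (c s) = d n (c t) \<and> d k (c s) = d k (c t)}" if "n < k" "k < N" for n k
  proof (rule countable_crossings[where f' = "g n" and g' = "g k"])
    show "((\<lambda>s. d n (c s)) has_real_derivative g n s) (at s)" "((\<lambda>s. d k (c s)) has_real_derivative g k s) (at s)"
      if "s \<in> A n \<union> A k" for s using that A_deriv by blast+
    show "g n s \<noteq> 0 \<and> \<bar>g k s\<bar> \<le> \<bar>g n s\<bar>" if "s \<in> A n" for s
      using AD(4,5)[OF that] \<open>k < N\<close> by blast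
    show "\<bar>g n s\<bar> < \<bar>g k s\<bar>" if "s \<in> A k" for s
      using AD(6)[OF that] \<open>n < k\<close> by blast
  qed
  then have Z: "countable Z" unfolding Z_def by (intro countable_UN) auto
  have [measurable]: "Z \<in> sets borel" using Z by (rule sets.countable[rotated]) simp
  define B where "B = (\<lambda>n. A n - Z)"
  have B_meas[measurable]: "B n \<in> sets borel" for n unfolding B_def by measurable
  \<comment> \<open>The finite measure whose total mass is to be estimated; compact parts are chosen large with respect to it.\<close>
  define \<nu> where "\<nu> = density lborel (\<lambda>t. M t * indicator {a..b} t)"
  have \<nu>_sets[simp, measurable_cong]: "sets \<nu> = sets borel" by (simp add: \<nu>_def)
  have \<nu>_eq: "emeasure \<nu> S = (\<integral>\<^sup>+t. M t * indicator {a..b} t * indicator S t \<partial>lborel)" if "S \<in> sets borel" for S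
    unfolding \<nu>_def using that by (subst emeasure_density) auto
  have "emeasure \<nu> (space \<nu>) = (\<integral>\<^sup>+t. M t * indicator {a..b} t \<partial>lborel)"
    using \<nu>_eq[of UNIV] by (simp add: \<nu>_def)
  also have "\<dots> \<le> (\<integral>\<^sup>+t. (\<Sum>n<N. ennreal (\<bar>g n t\<bar> powr p) * indicator {a..b} t) \<partial>lborel)"
  proof (rule nn_integral_mono)
    fix t
    have "M t \<le> (\<Sum>n<N. ennreal (\<bar>g n t\<bar> powr p))"
      unfolding M_def by (intro SUP_least member_le_sum) auto
    then show "M t * indicator {a..b} t \<le> (\<Sum>n<N. ennreal (\<bar>g n t\<bar> powr p) * indicator {a..b} t)"
      unfolding sum_distrib_right[symmetric] by (rule mult_right_mono) simp
  qed
  also have "\<dots> = (\<Sum>n<N. \<integral>\<^sup>+t. ennreal (\<bar>g n t\<bar> powr p) * indicator {a..b} t \<partial>lborel)"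
    by (rule nn_integral_sum) measurable
  also have "\<dots> < top" using gC by (simp add: le_less_trans[OF gC ennreal_less_top])
  finally have \<nu>_fin: "emeasure \<nu> (space \<nu>) \<noteq> \<infinity>" by simp
  have A_disj: "n = k" if "t \<in> A n" "t \<in> A k" "n < N" "k < N" for t n k
    using AD(5,6)[OF that(1)] AD(5,6)[OF that(2)] that(3,4)
    by (cases n k rule: linorder_cases) (metis not_less)+
  have "emeasure \<nu> (space \<nu>) \<le> (\<integral>\<^sup>+t. (\<Sum>n<N. M t * indicator {a..b} t * indicator (B n) t) \<partial>lborel)"
  proof -
    have "AE t in lborel. t \<notin> Z" using Z by (intro AE_not_in countable_imp_null_set_lborel)
    then have "AE t in lborel. M t * indicator {a..b} t \<le> (\<Sum>n<N. M t * indicator {a..b} t * indicator (B n) t)"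
      using AE_lborel_singleton[of a] AE_lborel_singleton[of b] AE_not_in[OF N0(1)]
    proof eventually_elim
      case (elim t)
      show ?case
      proof (cases "M t * indicator {a..b} t = 0")
        case False
        then have t: "a < t" "t < b" and Mt: "M t \<noteq> 0" using elim by (auto simp: indicator_def split: if_splits)
        define m where "m = Max ((\<lambda>n. \<bar>g n t\<bar>) ` {..<N})"
        have N: "{..<N} \<noteq> {}" using Mt unfolding M_def by (metis SUP_empty bot_ennreal)
        have m: "\<bar>g n t\<bar> \<le> m" if "n < N" for n using that unfolding m_def by (intro Max_ge) auto
        have "m \<in> (\<lambda>n. \<bar>g n t\<bar>) ` {..<N}" unfolding m_def using N by (intro Max_in) auto
        then have ex: "\<exists>n. n < N \<and> \<bar>g n t\<bar> = m" by auto
        define n where "n = (LEAST n. n < N \<and> \<bar>g n t\<bar> = m)"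
        have n: "n < N" "\<bar>g n t\<bar> = m" using LeastI_ex[OF ex] by (auto simp: n_def)
        have least: "\<bar>g k t\<bar> < m" if "k < n" for k
          using not_less_Least[of k "\<lambda>n. n < N \<and> \<bar>g n t\<bar> = m"] that m[of k] n(1) by (force simp: n_def)
        have "m \<noteq> 0"
        proof
          assume "m = 0"
          then have "g k t = 0" if "k < N" for k using m[OF that] by simp
          then have "M t = 0" unfolding M_def using p N by (simp add: SUP_eq_const)
          then show False using Mt by simp
        qed
        then have "g n t \<noteq> 0" using n(2) by auto
        then have "t \<in> A n" unfolding A_def using t elim(4) n m least by simp
        then have "t \<in> B n" using elim(1) by (simp add: B_def)
        then have "M t * indicator {a..b} t = M t * indicator {a..b} t * indicator (B n) t" by simp
        also have "\<dots> \<le> (\<Sum>n<N. M t * indicator {a..b} t * indicator (B n) t)"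
          by (rule member_le_sum[where f = "\<lambda>n. M t * indicator {a..b} t * indicator (B n) t"]) (use n in auto)
        finally show ?thesis .
      next
        case True
        then show ?thesis by (simp only: zero_le)
      qed
    qed
    then show ?thesis using \<nu>_eq[of UNIV] by (simp add: \<nu>_def nn_integral_mono_AE)
  qed
  also have "\<dots> = (\<Sum>n<N. emeasure \<nu> (B n))"
    by (subst nn_integral_sum) (auto simp: \<nu>_eq)
  finally have \<nu>B: "emeasure \<nu> (space \<nu>) \<le> (\<Sum>n<N. emeasure \<nu> (B n))" .
  have "emeasure \<nu> (space \<nu>) \<le> ennreal (2 powr p * (2 * C)) + ennreal e" if e: "0 < e" for e
  proof -
    have "\<exists>K. compact K \<and> K \<subseteq> B n \<and> emeasure \<nu> (B n) \<le> emeasure \<nu> K + ennreal (e / Suc N)" for n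
      using inner_regular_approx[OF \<nu>_sets \<nu>_fin B_meas[of n], of "e / Suc N"] e by (metis divide_pos_pos of_nat_0_less_iff zero_less_Suc)
    then obtain K where K: "\<And>n. compact (K n)" "\<And>n. K n \<subseteq> B n"
      "\<And>n. emeasure \<nu> (B n) \<le> emeasure \<nu> (K n) + ennreal (e / Suc N)" by metis
    have [measurable]: "K n \<in> sets borel" for n using K(1) by (simp add: borel_compact)
    have K_sub: "K n \<subseteq> {a..b}" for n using K(2)[of n] AD(1,2) by (fastforce simp: B_def)
    have Kc: "compact (c ` K n)" for n
      by (rule compact_continuous_image[OF continuous_on_subset[OF cont K_sub] K(1)])
    have disj_less: "c ` K n \<inter> c ` K k = {}" if "n < k" "k < N" for n k
    proof (rule ccontr)
      assume "c ` K n \<inter> c ` K k \<noteq> {}"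
      then obtain s t where st: "s \<in> K n" "t \<in> K k" "c s = c t" by auto
      then have "s \<in> A n" "t \<in> A k" "s \<notin> Z" using K(2) by (auto simp: B_def)
      then show False using that st(3) unfolding Z_def by auto
    qed
    have disj: "c ` K n \<inter> c ` K k = {}" if "n < N" "k < N" "n \<noteq> k" for n k
      using disj_less[of n k] disj_less[of k n] that by (metis Int_commute linorder_neqE_nat)
    obtain \<delta> where \<delta>: "0 < \<delta>"
      "\<And>\<phi>. 1-lipschitz_on UNIV \<phi> \<Longrightarrow> (\<And>x. \<bar>\<phi> x\<bar> \<le> 1) \<Longrightarrow>
        \<exists>h. 1-lipschitz_on UNIV h \<and> (\<forall>n<N. \<forall>y\<in>c ` K n. h y = \<delta> * \<phi> (d n y / \<delta>))"
      using separated_oscillations[of N "\<lambda>n. c ` K n" d, OF Kc disj d] by blast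
    obtain h1 where h1: "1-lipschitz_on UNIV h1" "\<And>n s. n < N \<Longrightarrow> s \<in> K n \<Longrightarrow> h1 (c s) = \<delta> * sin (d n (c s) / \<delta>)"
      using \<delta>(2)[OF lipschitz_sin abs_sin_le_one] by auto
    obtain h2 where h2: "1-lipschitz_on UNIV h2" "\<And>n s. n < N \<Longrightarrow> s \<in> K n \<Longrightarrow> h2 (c s) = \<delta> * cos (d n (c s) / \<delta>)"
      using \<delta>(2)[OF lipschitz_cos abs_cos_le_one] by auto
    obtain g1 where [measurable]: "g1 \<in> borel_measurable borel"
      and g1: "AE t in lborel. a < t \<longrightarrow> t < b \<longrightarrow> ((\<lambda>t. h1 (c t)) has_real_derivative g1 t) (at t)"
      "(\<integral>\<^sup>+t. ennreal (\<bar>g1 t\<bar> powr p) * indicator {a..b} t \<partial>lborel) \<le> ennreal C"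
      using D[OF h1(1)] by blast
    obtain g2 where [measurable]: "g2 \<in> borel_measurable borel"
      and g2: "AE t in lborel. a < t \<longrightarrow> t < b \<longrightarrow> ((\<lambda>t. h2 (c t)) has_real_derivative g2 t) (at t)"
      "(\<integral>\<^sup>+t. ennreal (\<bar>g2 t\<bar> powr p) * indicator {a..b} t \<partial>lborel) \<le> ennreal C"
      using D[OF h2(1)] by blast
    \<comment> \<open>The countably many isolated points of the compact parts, where the values on the part do not determine a derivative.\<close>
    define Q where "Q = (\<Union>n. {t\<in>K n. \<not> t islimpt K n})"
    have "countable Q" unfolding Q_def by (intro countable_UN countable_non_limit_points) auto
    then have "AE t in lborel. t \<notin> Q" by (intro AE_not_in countable_imp_null_set_lborel)
    then have AEK: "AE t in lborel. (\<Sum>n<N. M t * indicator {a..b} t * indicator (K n) t)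
        \<le> ennreal (2 powr p) * (ennreal (\<bar>g1 t\<bar> powr p) * indicator {a..b} t + ennreal (\<bar>g2 t\<bar> powr p) * indicator {a..b} t)"
      using g1(1) g2(1)
    proof eventually_elim
      case (elim t)
      show ?case
      proof (cases "\<exists>n<N. t \<in> K n")
        case False
        then have "(\<Sum>n<N. M t * indicator {a..b} t * indicator (K n) t) = 0"
          by (intro sum.neutral) auto
        then show ?thesis by (simp only: zero_le)
      next
        case True
        then obtain n where n: "n < N" "t \<in> K n" by blast
        have tA: "t \<in> A n" using K(2)[of n] n by (auto simp: B_def)
        have "t \<notin> K k" if "k < N" "k \<noteq> n" for k
          using A_disj[OF tA, of k] K(2)[of k] n that by (auto simp: B_def)
        then have "(\<Sum>k<N. M t * indicator {a..b} t * indicator (K k) t) = M t * indicator {a..b} t * indicator (K n) t"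
          using n by (intro sum.mono_neutral_cong_right[of "{..<N}" "{n}", THEN trans]) auto
        also have "\<dots> = M t" using n K_sub[of n] by auto
        also have "M t = ennreal (\<bar>g n t\<bar> powr p)"
          unfolding M_def
        proof (rule antisym)
          show "(SUP k\<in>{..<N}. ennreal (\<bar>g k t\<bar> powr p)) \<le> ennreal (\<bar>g n t\<bar> powr p)"
            using AD(5)[OF tA] p by (intro SUP_least ennreal_leI powr_mono2) auto
        qed (use n in \<open>auto intro: SUP_upper\<close>)
        also have "\<dots> \<le> ennreal (2 powr p * (\<bar>g1 t\<bar> powr p + \<bar>g2 t\<bar> powr p))"
        proof (rule ennreal_leI, rule oscillation_derivative_bound[where K = "K n" and c = c and d = "d n" and ?h1.0 = h1 and ?h2.0 = h2 and \<delta> = \<delta>])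
          show "t islimpt K n" using elim(1) n(2) by (auto simp: Q_def)
          show "((\<lambda>s. d n (c s)) has_real_derivative g n t) (at t)" by (rule A_deriv[OF tA])
          show "((\<lambda>s. h1 (c s)) has_real_derivative g1 t) (at t)" "((\<lambda>s. h2 (c s)) has_real_derivative g2 t) (at t)"
            using elim(2,3) AD(1,2)[OF tA] by blast+
        qed (use n \<delta>(1) p h1(2) h2(2) in blast)+
        also have "\<dots> = ennreal (2 powr p) * (ennreal (\<bar>g1 t\<bar> powr p) * indicator {a..b} t + ennreal (\<bar>g2 t\<bar> powr p) * indicator {a..b} t)"
          using n K_sub[of n] by (auto simp: ennreal_mult ennreal_plus)
        finally show ?thesis .
      qed
    qed
    have "(\<Sum>n<N. emeasure \<nu> (K n)) = (\<integral>\<^sup>+t. (\<Sum>n<N. M t * indicator {a..b} t * indicator (K n) t) \<partial>lborel)"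
      by (subst nn_integral_sum) (auto simp: \<nu>_eq)
    also have "\<dots> \<le> (\<integral>\<^sup>+t. ennreal (2 powr p) * (ennreal (\<bar>g1 t\<bar> powr p) * indicator {a..b} t + ennreal (\<bar>g2 t\<bar> powr p) * indicator {a..b} t) \<partial>lborel)"
      by (rule nn_integral_mono_AE[OF AEK])
    also have "\<dots> = ennreal (2 powr p) * ((\<integral>\<^sup>+t. ennreal (\<bar>g1 t\<bar> powr p) * indicator {a..b} t \<partial>lborel)
        + (\<integral>\<^sup>+t. ennreal (\<bar>g2 t\<bar> powr p) * indicator {a..b} t \<partial>lborel))"
      by (simp add: nn_integral_cmult nn_integral_add)
    also have "\<dots> \<le> ennreal (2 powr p) * (ennreal C + ennreal C)"
      using g1(2) g2(2) by (intro mult_left_mono add_mono) auto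
    also have "\<dots> = ennreal (2 powr p * (2 * C))"
      using C by (simp add: ennreal_mult flip: ennreal_plus)
    finally have sumK: "(\<Sum>n<N. emeasure \<nu> (K n)) \<le> ennreal (2 powr p * (2 * C))" .
    have "emeasure \<nu> (space \<nu>) \<le> (\<Sum>n<N. emeasure \<nu> (K n) + ennreal (e / Suc N))"
      using \<nu>B sum_mono[of "{..<N}", OF K(3)] by (rule order_trans)
    also have "\<dots> = (\<Sum>n<N. emeasure \<nu> (K n)) + (\<Sum>n<N. ennreal (e / Suc N))"
      by (rule sum.distrib)
    also have "\<dots> \<le> ennreal (2 powr p * (2 * C)) + ennreal e"
    proof (rule add_mono[OF sumK])
      have "(\<Sum>n<N. ennreal (e / Suc N)) = ennreal (\<Sum>n<N. e / Suc N)"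
        using e by (intro sum_ennreal) simp
      also have "\<dots> \<le> ennreal e"
      proof (rule ennreal_leI)
        have "real N * e \<le> real (Suc N) * e" using e by (intro mult_right_mono) auto
        then show "(\<Sum>n<N. e / Suc N) \<le> e" by (simp add: pos_divide_le_eq mult.commute)
      qed
      finally show "(\<Sum>n<N. ennreal (e / Suc N)) \<le> ennreal e" .
    qed
    finally show ?thesis .
  qed
  then have "emeasure \<nu> (space \<nu>) \<le> ennreal (2 powr p * (2 * C))"
    by (rule ennreal_le_epsilon)
  then show ?thesis using \<nu>_eq[of UNIV] by (simp add: \<nu>_def M_def)
qed

section \<open>Curves in a separable metric space\<close>

lemma dense_sequence:
  obtains x :: "nat \<Rightarrow> 'a::{metric_space, second_countable_topology}"
  where "\<And>y e. 0 < e \<Longrightarrow> \<exists>n. dist (x n) y < e"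
proof -
  obtain D :: "'a set" where D: "countable D" "\<And>X. open X \<Longrightarrow> X \<noteq> {} \<Longrightarrow> \<exists>d\<in>D. d \<in> X"
    by (rule countable_dense_setE) blast
  show thesis
  proof (rule that[of "from_nat_into D"])
    fix y :: 'a and e :: real assume e: "0 < e"
    obtain z where "z \<in> D" "z \<in> ball y e" using D(2)[of "ball y e"] e by auto
    then show "\<exists>n. dist (from_nat_into D n) y < e"
      using from_nat_into_surj[OF D(1)] by (auto simp: dist_commute)
  qed
qed

lemma lipschitz_dist: "1-lipschitz_on UNIV (dist (x::'a::metric_space))"
  by (intro lipschitz_onI) (use abs_dist_diff_le[of _ x] in \<open>simp_all add: dist_real_def dist_commute[of x]\<close>)

text \<open>
  The supremum of the derivatives of all distance functions to a dense sequence is in \<open>L\<^sub>p\<close> by the uniform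
  bound for finite maxima and monotone convergence. It dominates every distance function along the curve, and the distance of two
  points is approximated by distances to a point of the sequence near one of them.
\<close>

lemma continuous_curve_Lp_dominated:
  fixes c :: "real \<Rightarrow> 'a::{metric_space, second_countable_topology}"
  assumes ab: "a < b" and p: "1 < p" and cont: "continuous_on {a..b} c"
    and dom: "\<And>h::'a \<Rightarrow> real. (\<exists>C. C-lipschitz_on UNIV h) \<Longrightarrow> Lp_dominated p {a..b} (\<lambda>t. h (c t))"
  shows "Lp_dominated p {a..b} c"
proof -
  define deriv_bound where "deriv_bound = (\<lambda>C h g. integrable lborel g \<and>
      (\<forall>s t. a \<le> s \<longrightarrow> s \<le> t \<longrightarrow> t \<le> b \<longrightarrow> h (c t) - h (c s) = integral {s..t} g) \<and>
      (AE t in lborel. a < t \<longrightarrow> t < b \<longrightarrow> ((\<lambda>t. h (c t)) has_real_derivative g t) (at t)) \<and>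
      (\<integral>\<^sup>+t. ennreal (\<bar>g t\<bar> powr p) * indicator {a..b} t \<partial>lborel) \<le> ennreal C)"
  have "\<exists>C\<ge>0. \<forall>h. 1-lipschitz_on UNIV h \<longrightarrow> (\<exists>g. deriv_bound C h g)"
  proof (rule uniform_derivative_bound[OF ab p dom])
    fix C :: real
    assume "0 \<le> C" and "\<And>h. 1-lipschitz_on UNIV h \<Longrightarrow> \<exists>g. integrable lborel g \<and>
      (\<forall>s t. a \<le> s \<longrightarrow> s \<le> t \<longrightarrow> t \<le> b \<longrightarrow> h (c t) - h (c s) = integral {s..t} g) \<and>
      (AE t in lborel. a < t \<longrightarrow> t < b \<longrightarrow> ((\<lambda>t. h (c t)) has_real_derivative g t) (at t)) \<and>
      (\<integral>\<^sup>+t. ennreal (\<bar>g t\<bar> powr p) * indicator {a..b} t \<partial>lborel) \<le> ennreal C"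
    then show ?thesis unfolding deriv_bound_def by blast
  qed
  then obtain C where C: "0 \<le> C" "\<And>h. 1-lipschitz_on UNIV h \<Longrightarrow> \<exists>g. deriv_bound C h g"
    by blast
  obtain x :: "nat \<Rightarrow> 'a" where dense: "\<And>y e. 0 < e \<Longrightarrow> \<exists>n. dist (x n) y < e"
    by (rule dense_sequence) blast
  have "\<exists>g. \<forall>n. deriv_bound C (dist (x n)) (g n)"
    using C(2)[OF lipschitz_dist] by (rule choice[OF allI])
  then obtain g where g: "\<And>n. integrable lborel (g n)"
    "\<And>n s t. a \<le> s \<Longrightarrow> s \<le> t \<Longrightarrow> t \<le> b \<Longrightarrow> dist (x n) (c t) - dist (x n) (c s) = integral {s..t} (g n)"
    "\<And>n. AE t in lborel. a < t \<longrightarrow> t < b \<longrightarrow> ((\<lambda>t. dist (x n) (c t)) has_real_derivative g n t) (at t)"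
    "\<And>n. (\<integral>\<^sup>+t. ennreal (\<bar>g n t\<bar> powr p) * indicator {a..b} t \<partial>lborel) \<le> ennreal C"
    unfolding deriv_bound_def by blast
  have gm[measurable]: "g n \<in> borel_measurable borel" for n using g(1)[of n] by auto
  define M where "M = (\<lambda>N t. (SUP n\<in>{..<N}. ennreal (\<bar>g n t\<bar> powr p)) * indicator {a..b} t)"
  define W where "W = (\<lambda>t. SUP N. M N t)"
  have Mm[measurable]: "M N \<in> borel_measurable borel" for N unfolding M_def by measurable
  have Wm[measurable]: "W \<in> borel_measurable borel" unfolding W_def by measurable
  have MN: "(\<integral>\<^sup>+t. M N t \<partial>lborel) \<le> ennreal (2 powr p * (2 * C))" for N
    unfolding M_def
  proof (rule max_derivative_integral_le[OF _ C(1) cont _ lipschitz_dist gm g(3,4)])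
    fix h :: "'a \<Rightarrow> real" assume "1-lipschitz_on UNIV h"
    from C(2)[OF this, unfolded deriv_bound_def] obtain f where f: "integrable lborel f"
      "AE t in lborel. a < t \<longrightarrow> t < b \<longrightarrow> ((\<lambda>t. h (c t)) has_real_derivative f t) (at t)"
      "(\<integral>\<^sup>+t. ennreal (\<bar>f t\<bar> powr p) * indicator {a..b} t \<partial>lborel) \<le> ennreal C" by blast
    have "f \<in> borel_measurable borel" using f(1) by auto
    with f(2,3) show "\<exists>g\<in>borel_measurable borel.
      (AE t in lborel. a < t \<longrightarrow> t < b \<longrightarrow> ((\<lambda>t. h (c t)) has_real_derivative g t) (at t)) \<and>
      (\<integral>\<^sup>+t. ennreal (\<bar>g t\<bar> powr p) * indicator {a..b} t \<partial>lborel) \<le> ennreal C" by blast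
  qed (use p in simp)
  have "incseq M"
    unfolding M_def by (intro monoI le_funI mult_right_mono SUP_subset_mono) auto
  then have "(\<integral>\<^sup>+t. W t \<partial>lborel) = (SUP N. \<integral>\<^sup>+t. M N t \<partial>lborel)"
    unfolding W_def by (intro nn_integral_monotone_convergence_SUP) auto
  also have "\<dots> \<le> ennreal (2 powr p * (2 * C))" by (intro SUP_least MN)
  finally have W_int: "(\<integral>\<^sup>+t. W t \<partial>lborel) < \<infinity>"
    by (simp add: le_less_trans[OF _ ennreal_less_top])
  then have W_fin: "AE t in lborel. W t \<noteq> \<infinity>" by (intro nn_integral_PInf_AE) auto
  define G where "G = (\<lambda>t. enn2real (W t) powr (1 / p))"
  have Gm[measurable]: "G \<in> borel_measurable borel" unfolding G_def by measurable
  have G0: "0 \<le> G t" for t by (simp add: G_def)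
  have Gp: "G t powr p = enn2real (W t)" for t using p by (simp add: G_def powr_powr)
  have Gp_int: "integrable lborel (\<lambda>t. G t powr p)"
    unfolding Gp
  proof (rule integrableI_nonneg)
    have "(\<integral>\<^sup>+t. ennreal (enn2real (W t)) \<partial>lborel) = (\<integral>\<^sup>+t. W t \<partial>lborel)"
      using W_fin by (intro nn_integral_cong_AE) (auto elim!: eventually_mono simp: less_top)
    then show "(\<integral>\<^sup>+t. ennreal (enn2real (W t)) \<partial>lborel) < \<infinity>" using W_int by simp
  qed auto
  have W_out: "W t = 0" if "t \<notin> {a..b}" for t using that by (simp add: W_def M_def)
  have G_int: "integrable lborel G"
    using p G0 Gp_int by (intro integrable_if_powr_integrable[of p G a b]) (auto simp: G_def W_out)
  have gG: "AE t in lborel. t \<in> {a..b} \<longrightarrow> \<bar>g n t\<bar> \<le> G t" for n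
    using W_fin
  proof eventually_elim
    case (elim t)
    show ?case
    proof
      assume t: "t \<in> {a..b}"
      have "ennreal (\<bar>g n t\<bar> powr p) \<le> (SUP k\<in>{..<Suc n}. ennreal (\<bar>g k t\<bar> powr p))"
        by (rule SUP_upper) simp
      also have "\<dots> = M (Suc n) t" using t by (simp add: M_def)
      also have "\<dots> \<le> W t" unfolding W_def by (rule SUP_upper) simp
      also have "W t = ennreal (enn2real (W t))" using elim by (simp add: less_top)
      finally have "\<bar>g n t\<bar> powr p \<le> G t powr p" by (simp add: Gp)
      then show "\<bar>g n t\<bar> \<le> G t"
        using powr_less_mono2[of p "G t" "\<bar>g n t\<bar>"] p G0[of t] by linarith
    qed
  qed
  have "dist (c s) (c t) \<le> integral {s..t} G" if st: "a \<le> s" "s \<le> t" "t \<le> b" for s t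
  proof (rule field_le_epsilon)
    fix e :: real assume e: "0 < e"
    obtain n where n: "dist (x n) (c s) < e / 2" using dense[of "e / 2" "c s"] e by auto
    have "integral {s..t} (g n) = (LINT u:{s..t}|lborel. g n u)"
      by (rule LINT_Icc_eq_integral(1)[OF g(1), symmetric])
    also have "\<dots> \<le> (LINT u:{s..t}|lborel. G u)"
      unfolding set_lebesgue_integral_def
    proof (rule integral_mono_AE)
      show "integrable lborel (\<lambda>u. indicator {s..t} u *\<^sub>R g n u)" "integrable lborel (\<lambda>u. indicator {s..t} u *\<^sub>R G u)"
        using set_integrable_lborel_Icc[OF g(1)] set_integrable_lborel_Icc[OF G_int] by (auto simp: set_integrable_def)
      show "AE u in lborel. indicator {s..t} u *\<^sub>R g n u \<le> indicator {s..t} u *\<^sub>R G u"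
        using gG[of n] by eventually_elim (use st in \<open>auto simp: indicator_def\<close>)
    qed
    also have "\<dots> = integral {s..t} G" by (rule LINT_Icc_eq_integral(1)[OF G_int])
    finally have "dist (x n) (c t) - dist (x n) (c s) \<le> integral {s..t} G" using g(2)[OF st] by simp
    then show "dist (c s) (c t) \<le> integral {s..t} G + e"
      using n dist_triangle[of "c s" "c t" "x n"] by (simp add: dist_commute)
  qed
  then show ?thesis
    unfolding Lp_dominated_def using G_int Gp_int G0 by (intro exI[of _ G]) auto
qed

lemma conull_dense_Icc:
  fixes a b :: real
  assumes ab: "a < b" and E: "E \<in> sets borel" "emeasure lborel ({a..b} - E) = 0"
  shows "{a..b} \<subseteq> closure E"
proof
  fix x assume x: "x \<in> {a..b}"
  show "x \<in> closure E"
  proof (rule ccontr)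
    assume "x \<notin> closure E"
    then obtain e where e: "0 < e" "\<And>y. dist y x < e \<Longrightarrow> y \<notin> E"
      unfolding closure_approachable by auto
    let ?u = "max a (x - e)" and ?v = "min b (x + e)"
    have uv: "?u < ?v" using x e ab by auto
    have "{?u<..<?v} \<subseteq> {a..b} - E"
      using e(2) by (auto simp: dist_real_def)
    then have "emeasure lborel {?u<..<?v} \<le> emeasure lborel ({a..b} - E)"
      using E(1) by (intro emeasure_mono) auto
    moreover have "emeasure lborel {?u<..<?v} = ennreal (?v - ?u)"
      using uv by (intro emeasure_lborel_Ioo) simp
    ultimately have "ennreal (?v - ?u) = 0" using E(2) by simp
    then show False using uv by (simp add: ennreal_eq_0_iff)
  qed
qed

text \<open>
  Near a time \<open>t\<close>, the distance to a point of the sequence that is close to \<open>c t\<close> stays small.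
\<close>

lemma continuous_on_if_dense_distances_continuous:
  fixes c :: "real \<Rightarrow> 'a::metric_space" and x :: "nat \<Rightarrow> 'a"
  assumes dense: "\<And>y e. 0 < e \<Longrightarrow> \<exists>n. dist (x n) y < e"
    and cont: "\<And>n. continuous_on S (\<lambda>t. dist (x n) (c t))"
  shows "continuous_on S c"
  unfolding continuous_on_iff
proof (intro ballI allI impI)
  fix t e :: real assume t: "t \<in> S" and e: "0 < e"
  obtain n where n: "dist (x n) (c t) < e / 3" using dense[of "e / 3" "c t"] e by auto
  obtain d where d: "d > 0" "\<And>s. s \<in> S \<Longrightarrow> dist s t < d \<Longrightarrow> dist (dist (x n) (c s)) (dist (x n) (c t)) < e / 3"
    using cont[of n] t e unfolding continuous_on_iff by (metis divide_pos_pos zero_less_numeral)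
  have "dist (c s) (c t) < e" if "s \<in> S" "dist s t < d" for s
    using d(2)[OF that] n dist_triangle3[of "c s" "c t" "x n"] unfolding dist_real_def by linarith
  then show "\<exists>d>0. \<forall>s\<in>S. dist s t < d \<longrightarrow> dist (c s) (c t) < e" using d(1) by blast
qed

text \<open>
  The bound says that \<open>c\<close> is Hoelder continuous with exponent \<open>1 - 1 / p\<close>.
\<close>

lemma uniformly_continuous_on_powr_bound:
  fixes c :: "real \<Rightarrow> 'a::metric_space"
  assumes p: "1 < p" and C: "0 \<le> C"
    and bound: "\<And>s t. s \<in> S \<Longrightarrow> t \<in> S \<Longrightarrow> s < t \<Longrightarrow> (t - s) powr (1 - p) * dist (c s) (c t) powr p \<le> C"
  shows "uniformly_continuous_on S c"
  unfolding uniformly_continuous_on_def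
proof (intro allI impI)
  fix e :: real assume e: "0 < e"
  define d where "d = (e powr p / (C + 1)) powr (1 / (p - 1))"
  have d: "0 < d" using e C by (simp add: d_def)
  have d_powr: "(C + 1) * d powr (p - 1) = e powr p" using p C by (simp add: d_def powr_powr)
  have less: "dist (c s) (c t) < e" if "s \<in> S" "t \<in> S" "s < t" "t - s < d" for s t
  proof (rule ccontr)
    assume "\<not> dist (c s) (c t) < e"
    then have "e powr p \<le> dist (c s) (c t) powr p" using e p by (intro powr_mono2) auto
    moreover have "dist (c s) (c t) powr p = (t - s) powr (p - 1) * ((t - s) powr (1 - p) * dist (c s) (c t) powr p)"
      using that(3) by (simp add: mult.assoc[symmetric] powr_add[symmetric])
    moreover have "\<dots> \<le> (t - s) powr (p - 1) * C" by (intro mult_left_mono bound that) simp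
    moreover have "\<dots> \<le> d powr (p - 1) * C" using that p C by (intro mult_right_mono powr_mono2) auto
    ultimately have "(C + 1) * d powr (p - 1) \<le> d powr (p - 1) * C" using d_powr by linarith
    then show False using d by (simp add: distrib_right mult.commute)
  qed
  have "dist (c s) (c t) < e" if "s \<in> S" "t \<in> S" "dist s t < d" for s t
    using less[of s t] less[of t s] that e
    by (cases s t rule: linorder_cases) (auto simp: dist_real_def dist_commute)
  then show "\<exists>d>0. \<forall>x\<in>S. \<forall>x'\<in>S. dist x' x < d \<longrightarrow> dist (c x') (c x) < e" using d by blast
qed

text \<open>
  Each \<open>h\<close> comes with its own exceptional null set. Distances to a dense sequence need only countably many
  of them, so \<open>\<gamma>\<close> is continuous on a set \<open>E\<close> of full measure; by density, every \<open>h \<circ> \<gamma>\<close> is then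
  dominated on this fixed set \<open>E\<close>. The uniform boundedness principle, applied to single increments and then to
  the functions \<open>dist (\<gamma> s)\<close>, makes \<open>\<gamma>\<close> uniformly continuous on \<open>E\<close>. By completeness it extends to a continuous curve, to which the
  result for continuous curves applies.
\<close>

lemma Lp_dominated_if_lipschitz_compositions:
  fixes \<gamma> :: "real \<Rightarrow> 'a::polish_space"
  assumes ab: "a < b" and p: "1 < p"
    and comp: "\<And>h::'a \<Rightarrow> real. (\<exists>C. C-lipschitz_on UNIV h) \<Longrightarrow>
      \<exists>E. E \<in> sets borel \<and> E \<subseteq> {a..b} \<and> emeasure lborel ({a..b} - E) = 0 \<and> Lp_dominated p E (\<lambda>t. h (\<gamma> t))"
  shows "\<exists>E. E \<in> sets borel \<and> E \<subseteq> {a..b} \<and> emeasure lborel ({a..b} - E) = 0 \<and> Lp_dominated p E \<gamma>"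
proof -
  obtain x :: "nat \<Rightarrow> 'a" where dense: "\<And>y e. 0 < e \<Longrightarrow> \<exists>n. dist (x n) y < e"
    by (rule dense_sequence) blast
  have "\<exists>F. \<forall>n. F n \<in> sets borel \<and> F n \<subseteq> {a..b} \<and> emeasure lborel ({a..b} - F n) = 0
      \<and> Lp_dominated p (F n) (\<lambda>t. dist (x n) (\<gamma> t))"
    using comp lipschitz_dist by (intro choice allI) blast
  then obtain F where F: "\<And>n. F n \<in> sets borel" "\<And>n. F n \<subseteq> {a..b}" "\<And>n. emeasure lborel ({a..b} - F n) = 0"
    "\<And>n. Lp_dominated p (F n) (\<lambda>t. dist (x n) (\<gamma> t))" by blast
  define E where "E = (\<Inter>n. F n)"
  have E_meas: "E \<in> sets borel" unfolding E_def using F(1) by auto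
  have E_sub: "E \<subseteq> {a..b}" unfolding E_def using F(2)[of 0] by blast
  have E_null: "{a..b} - E \<in> null_sets lborel"
  proof -
    have "{a..b} - E = (\<Union>n. {a..b} - F n)" unfolding E_def by blast
    moreover have "{a..b} - F n \<in> null_sets lborel" for n using F(1,3)[of n] by (auto simp: null_sets_def)
    ultimately show ?thesis by (simp only: null_sets_UN)
  qed
  have cont_E: "continuous_on E \<gamma>"
  proof (rule continuous_on_if_dense_distances_continuous[OF dense])
    show "continuous_on E (\<lambda>t. dist (x n) (\<gamma> t))" for n
      by (rule continuous_on_subset[OF Lp_dominated_imp_continuous_on[OF F(4,2)]]) (auto simp: E_def)
  qed
  have dom_E: "Lp_dominated p E (\<lambda>t. h (\<gamma> t))"
    if h: "\<exists>C. C-lipschitz_on UNIV h" for h :: "'a \<Rightarrow> real"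
  proof -
    obtain E' where E': "E' \<in> sets borel" "E' \<subseteq> {a..b}" "emeasure lborel ({a..b} - E') = 0" "Lp_dominated p E' (\<lambda>t. h (\<gamma> t))"
      using comp[OF h] by blast
    have "{a..b} - E' \<in> null_sets lborel" using E' by (auto simp: null_sets_def)
    then have "({a..b} - E) \<union> ({a..b} - E') \<in> null_sets lborel" using E_null by (rule null_sets.Un[rotated])
    moreover have "({a..b} - E) \<union> ({a..b} - E') = {a..b} - (E \<inter> E')" by blast
    ultimately have "{a..b} - (E \<inter> E') \<in> null_sets lborel" by simp
    then have cl: "{a..b} \<subseteq> closure (E \<inter> E')"
      using E_meas E'(1) by (intro conull_dense_Icc[OF ab]) (auto simp: null_sets_def)
    have dom: "Lp_dominated p (E \<inter> E') (\<lambda>t. h (\<gamma> t))"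
      using E'(4) unfolding Lp_dominated_def by blast
    obtain L where L: "L-lipschitz_on UNIV h" using h by blast
    have "continuous_on E (\<lambda>t. h (\<gamma> t))"
      by (rule continuous_on_compose2[OF lipschitz_on_continuous_on[OF L] cont_E]) simp
    then show "Lp_dominated p E (\<lambda>t. h (\<gamma> t))"
      using cl E_sub by (intro Lp_dominated_extend_dense[OF dom _ E_sub]) auto
  qed
  define PP where "PP = {[(\<gamma> s, \<gamma> t, (t - s) powr (1 - p))] | s t. s \<in> E \<and> t \<in> E \<and> s < t}"
  have "0 \<le> w" if "P \<in> PP" "(u, v, w) \<in> set P" for P u v w using that by (auto simp: PP_def)
  moreover have "\<exists>B. \<forall>P\<in>PP. weighted_variation p P h \<le> B" if h: "\<exists>C. C-lipschitz_on UNIV h" for h :: "'a \<Rightarrow> real"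
  proof -
    obtain G where G: "integrable lborel G" "integrable lborel (\<lambda>x. G x powr p)" "\<And>x. 0 \<le> G x"
      and hG: "\<And>s t. s \<in> E \<Longrightarrow> t \<in> E \<Longrightarrow> s \<le> t \<Longrightarrow> dist (h (\<gamma> s)) (h (\<gamma> t)) \<le> integral {s..t} G"
      using dom_E[OF h] unfolding Lp_dominated_def by blast
    have "(t - s) powr (1 - p) * \<bar>h (\<gamma> s) - h (\<gamma> t)\<bar> powr p \<le> integral {a..b} (\<lambda>x. G x powr p)"
      if st: "s \<in> E" "t \<in> E" "s < t" for s t
    proof -
      have "(t - s) powr (1 - p) * dist (h (\<gamma> s)) (h (\<gamma> t)) powr p \<le> integral {s..t} (\<lambda>x. G x powr p)"
        by (rule Lp_dominated_powr_increment[OF p G st(3) hG]) (use st in auto)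
      also have "\<dots> \<le> integral {a..b} (\<lambda>x. G x powr p)"
        using st E_sub LINT_Icc_eq_integral(2)[OF G(2)] by (intro integral_subset_le) auto
      finally show ?thesis by (simp add: dist_real_def)
    qed
    then show ?thesis by (intro exI[of _ "integral {a..b} (\<lambda>x. G x powr p)"]) (auto simp: PP_def weighted_variation_def)
  qed
  ultimately have "\<exists>C\<ge>0. \<forall>P\<in>PP. \<forall>h. 1-lipschitz_on UNIV h \<longrightarrow> weighted_variation p P h \<le> C"
    by (rule weighted_variation_uniform_bound[OF less_imp_le[OF p]]) blast+
  then obtain C where C: "0 \<le> C" "\<And>P h. P \<in> PP \<Longrightarrow> 1-lipschitz_on UNIV h \<Longrightarrow> weighted_variation p P h \<le> C" by blast
  have "uniformly_continuous_on E \<gamma>"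
  proof (rule uniformly_continuous_on_powr_bound[OF p C(1)])
    fix s t assume st: "s \<in> E" "t \<in> E" "s < t"
    then have "weighted_variation p [(\<gamma> s, \<gamma> t, (t - s) powr (1 - p))] (dist (\<gamma> s)) \<le> C"
      by (intro C(2) lipschitz_dist) (auto simp: PP_def)
    then show "(t - s) powr (1 - p) * dist (\<gamma> s) (\<gamma> t) powr p \<le> C" by (simp add: weighted_variation_def)
  qed
  then obtain c where c: "uniformly_continuous_on (closure E) c" "\<And>t. t \<in> E \<Longrightarrow> \<gamma> t = c t"
    by (rule uniformly_continuous_on_extension_on_closure) blast
  have cl_E: "{a..b} \<subseteq> closure E" using E_null E_meas by (intro conull_dense_Icc[OF ab]) (auto simp: null_sets_def)
  have cont_c: "continuous_on {a..b} c"
    using continuous_on_subset[OF uniformly_continuous_imp_continuous[OF c(1)] cl_E] .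
  have "Lp_dominated p {a..b} c"
  proof (rule continuous_curve_Lp_dominated[OF ab p cont_c])
    fix h :: "'a \<Rightarrow> real" assume h: "\<exists>C. C-lipschitz_on UNIV h"
    then obtain L where L: "L-lipschitz_on UNIV h" by blast
    have "Lp_dominated p E (\<lambda>t. h (c t))"
      using dom_E[OF h] order_refl by (rule Lp_dominated_cong_subset) (simp add: c(2))
    then show "Lp_dominated p {a..b} (\<lambda>t. h (c t))"
    proof (rule Lp_dominated_extend_dense[OF _ E_sub order_refl cl_E])
      show "continuous_on {a..b} (\<lambda>t. h (c t))"
        by (rule continuous_on_compose2[OF lipschitz_on_continuous_on[OF L] cont_c]) simp
    qed
  qed
  then have "Lp_dominated p E \<gamma>"
    using E_sub c(2) by (rule Lp_dominated_cong_subset)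
  then show ?thesis using E_meas E_sub E_null by (intro exI[of _ E]) (auto simp: null_sets_def)
qed

section \<open>Sobolev classes\<close>

lemma borel_map_on_iff_indicator:
  fixes f :: "real \<Rightarrow> real"
  shows "borel_map_on a b f \<longleftrightarrow> (\<lambda>x. indicator {a..b} x * f x) \<in> borel_measurable borel"
  unfolding interval_measure_space_def by (subst borel_measurable_restrict_space_iff) auto

lemma AE_interval_iff:
  "(AE t in interval_measure_space a b. P t) \<longleftrightarrow> (AE t in lborel. t \<in> {a..b} \<longrightarrow> P t)"
  unfolding interval_measure_space_def by (subst AE_restrict_space_iff) auto

lemma nn_integral_interval:
  "(\<integral>\<^sup>+t. f t \<partial>interval_measure_space a b) = (\<integral>\<^sup>+t. f t * indicator {a..b} t \<partial>lborel)"
  unfolding interval_measure_space_def by (subst nn_integral_restrict_space) auto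

lemma Lp_fun_iff_integrable:
  "f \<in> Lp_fun p a b \<longleftrightarrow> (\<lambda>x. indicator {a..b} x * f x) \<in> borel_measurable borel \<and>
    integrable lborel (\<lambda>x. indicator {a..b} x * \<bar>f x\<bar> powr p)"
proof (cases "(\<lambda>x. indicator {a..b} x * f x) \<in> borel_measurable borel")
  case True
  have eq: "indicator {a..b} x * \<bar>f x\<bar> powr p = indicator {a..b} x * \<bar>indicator {a..b} x * f x\<bar> powr p" for x
    by (simp add: indicator_def)
  have "(\<lambda>x. indicator {a..b} x * \<bar>f x\<bar> powr p) \<in> borel_measurable lborel"
    unfolding eq using True by measurable
  then have "integrable lborel (\<lambda>x. indicator {a..b} x * \<bar>f x\<bar> powr p)
      \<longleftrightarrow> (\<integral>\<^sup>+x. ennreal (indicator {a..b} x * \<bar>f x\<bar> powr p) \<partial>lborel) < \<infinity>"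
    by (simp add: integrable_iff_bounded)
  also have "(\<integral>\<^sup>+x. ennreal (indicator {a..b} x * \<bar>f x\<bar> powr p) \<partial>lborel)
      = (\<integral>\<^sup>+x. ennreal (\<bar>f x\<bar> powr p) * indicator {a..b} x \<partial>lborel)"
    by (intro nn_integral_cong) (simp add: indicator_def)
  finally show ?thesis
    using True unfolding Lp_fun_def nn_integral_interval borel_map_on_iff_indicator by simp
next
  case False
  then show ?thesis by (simp add: Lp_fun_def borel_map_on_iff_indicator)
qed

lemma Lp_fun_cong_AE:
  assumes "f \<in> Lp_fun p a b" "borel_map_on a b g" "AE t in interval_measure_space a b. g t = f t"
  shows "g \<in> Lp_fun p a b"
proof -
  have "(\<integral>\<^sup>+ t. ennreal (\<bar>g t\<bar> powr p) \<partial>interval_measure_space a b)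
      = (\<integral>\<^sup>+ t. ennreal (\<bar>f t\<bar> powr p) \<partial>interval_measure_space a b)"
    using assms(3) by (intro nn_integral_cong_AE) (auto elim!: eventually_mono)
  then show ?thesis using assms(1,2) unfolding Lp_fun_def by simp
qed

lemma Lp_map_cong_AE:
  fixes f g :: "real \<Rightarrow> 'a::polish_space"
  assumes f: "f \<in> Lp_map p a b" and g: "borel_map_on a b g" "AE t in interval_measure_space a b. g t = f t"
  shows "g \<in> Lp_map p a b"
proof -
  obtain y where y: "(\<lambda>t. dist y (f t)) \<in> Lp_fun p a b" using f unfolding Lp_map_def by blast
  have "(\<lambda>t. dist y (g t)) \<in> Lp_fun p a b"
  proof (rule Lp_fun_cong_AE[OF y])
    show "borel_map_on a b (\<lambda>t. dist y (g t))" using g(1) by measurable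
    show "AE t in interval_measure_space a b. dist y (g t) = dist y (f t)"
      using g(2) by eventually_elim simp
  qed
  then show ?thesis using g(1) unfolding Lp_map_def by blast
qed

text \<open>
  An affine bound preserves \<open>L\<^sub>p\<close> because constants are in \<open>L\<^sub>p\<close> on a bounded interval.
\<close>

lemma Lp_fun_scaled_bound:
  assumes p: "0 \<le> p" and f: "f \<in> Lp_fun p a b" and g: "borel_map_on a b g"
    and bound: "\<And>t. \<bar>g t\<bar> \<le> A + B * \<bar>f t\<bar>" and B: "0 \<le> B" and A: "0 \<le> A"
  shows "g \<in> Lp_fun p a b"
  unfolding Lp_fun_iff_integrable
proof
  let ?I = "indicator {a..b} :: real \<Rightarrow> real"
  show m: "(\<lambda>x. ?I x * g x) \<in> borel_measurable borel" using g borel_map_on_iff_indicator by blast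
  have eq: "?I x * \<bar>g x\<bar> powr p = ?I x * \<bar>?I x * g x\<bar> powr p" for x by (simp add: indicator_def)
  show "integrable lborel (\<lambda>x. ?I x * \<bar>g x\<bar> powr p)"
  proof (rule Bochner_Integration.integrable_bound)
    have "integrable lborel ?I" by (rule integrable_real_indicator) (auto simp: emeasure_lborel_Icc_eq)
    then show "integrable lborel (\<lambda>x. 2 powr p * (A powr p * ?I x + B powr p * (?I x * \<bar>f x\<bar> powr p)))"
      using f unfolding Lp_fun_iff_integrable
      by (intro integrable_mult_right Bochner_Integration.integrable_add) auto
    show "(\<lambda>x. ?I x * \<bar>g x\<bar> powr p) \<in> borel_measurable lborel" unfolding eq using m by measurable
    show "AE x in lborel. norm (?I x * \<bar>g x\<bar> powr p) \<le> norm (2 powr p * (A powr p * ?I x + B powr p * (?I x * \<bar>f x\<bar> powr p)))"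
    proof (rule AE_I2)
      fix x
      have "\<bar>g x\<bar> powr p \<le> \<bar>A + B * \<bar>f x\<bar>\<bar> powr p" using bound[of x] p by (intro powr_mono2) auto
      also have "\<dots> \<le> 2 powr p * (\<bar>A\<bar> powr p + \<bar>B * \<bar>f x\<bar>\<bar> powr p)" by (rule powr_abs_add_le[OF p])
      also have "\<dots> = 2 powr p * (A powr p + B powr p * \<bar>f x\<bar> powr p)"
        using A B by (simp add: powr_mult abs_mult)
      finally show "norm (?I x * \<bar>g x\<bar> powr p) \<le> norm (2 powr p * (A powr p * ?I x + B powr p * (?I x * \<bar>f x\<bar> powr p)))"
        by (cases "x \<in> {a..b}") auto
    qed
  qed
qed

lemma Lp_dominated_iff_Lp_fun:
  fixes \<gamma> :: "real \<Rightarrow> 'a::metric_space"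
  assumes p: "1 < p" and E: "E \<subseteq> {a..b}"
  shows "Lp_dominated p E \<gamma> \<longleftrightarrow> (\<exists>G. G \<in> Lp_fun p a b \<and> (\<forall>t\<in>{a..b}. 0 \<le> G t) \<and>
    (\<forall>t1\<in>E. \<forall>t2\<in>E. t1 \<le> t2 \<longrightarrow> dist (\<gamma> t1) (\<gamma> t2) \<le> (LINT t:{t1..t2}|lborel. G t)))"
    (is "_ \<longleftrightarrow> ?R")
proof
  assume "Lp_dominated p E \<gamma>"
  then obtain G where G: "integrable lborel G" "integrable lborel (\<lambda>x. G x powr p)" "\<And>x. 0 \<le> G x"
    "\<And>s t. s \<in> E \<Longrightarrow> t \<in> E \<Longrightarrow> s \<le> t \<Longrightarrow> dist (\<gamma> s) (\<gamma> t) \<le> integral {s..t} G"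
    unfolding Lp_dominated_def by blast
  have [measurable]: "G \<in> borel_measurable borel" using G(1) by auto
  have "integrable lborel (\<lambda>x. indicator {a..b} x * \<bar>G x\<bar> powr p)"
    using integrable_mult_indicator[of "{a..b}" lborel "\<lambda>x. G x powr p"] G(2,3) by simp
  then have "G \<in> Lp_fun p a b" unfolding Lp_fun_iff_integrable by simp
  then show ?R using G(3,4) LINT_Icc_eq_integral(1)[OF G(1)] by (intro exI[of _ G]) auto
next
  assume ?R
  then obtain G where G: "G \<in> Lp_fun p a b" "\<And>t. t \<in> {a..b} \<Longrightarrow> 0 \<le> G t"
    "\<And>s t. s \<in> E \<Longrightarrow> t \<in> E \<Longrightarrow> s \<le> t \<Longrightarrow> dist (\<gamma> s) (\<gamma> t) \<le> (LINT u:{s..t}|lborel. G u)" by blast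
  define H where "H = (\<lambda>x. indicator {a..b} x * G x)"
  have H0: "0 \<le> H x" for x using G(2) by (simp add: H_def indicator_def)
  have Hm[measurable]: "H \<in> borel_measurable borel" using G(1) unfolding Lp_fun_iff_integrable H_def by blast
  have Hp: "indicator {a..b} x * \<bar>G x\<bar> powr p = H x powr p" for x
    using G(2)[of x] p by (simp add: H_def indicator_def)
  have Hp_int: "integrable lborel (\<lambda>x. H x powr p)" using G(1) unfolding Lp_fun_iff_integrable Hp by blast
  have H_int: "integrable lborel H"
    by (rule integrable_if_powr_integrable[where a = a and b = b, OF less_imp_le[OF p] Hm H0 _ Hp_int]) (simp add: H_def)
  have "dist (\<gamma> s) (\<gamma> t) \<le> integral {s..t} H" if st: "s \<in> E" "t \<in> E" "s \<le> t" for s t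
  proof -
    have "(LINT u:{s..t}|lborel. G u) = (LINT u:{s..t}|lborel. H u)"
    proof (rule set_lebesgue_integral_cong)
      have "u \<in> {a..b}" if "u \<in> {s..t}" for u
        using subsetD[OF E st(1)] subsetD[OF E st(2)] that by auto
      then show "\<forall>u. u \<in> {s..t} \<longrightarrow> G u = H u" by (simp add: H_def)
    qed simp
    then show ?thesis using G(3)[OF st] LINT_Icc_eq_integral(1)[OF H_int, of s t] by simp
  qed
  then show "Lp_dominated p E \<gamma>" unfolding Lp_dominated_def using H_int Hp_int H0 by blast
qed

lemma ae_class_mem: "g \<in> ae_class a b f \<longleftrightarrow> borel_map_on a b g \<and> (AE t in interval_measure_space a b. g t = f t)"
  by (simp add: ae_class_def)

lemma ae_class_eq_imp_AE:
  assumes "borel_map_on a b f" "ae_class a b f = ae_class a b g"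
  shows "AE t in interval_measure_space a b. f t = g t"
proof -
  have "f \<in> ae_class a b f" using assms(1) by (simp add: ae_class_mem)
  then show ?thesis unfolding assms(2) ae_class_mem by blast
qed

text \<open>
  Membership of the class is defined by some representative. For a Borel map it can be tested on the map
  itself: the null set on which it differs from that representative is removed from \<open>E\<close>.
\<close>

lemma ae_class_in_W1p_iff:
  fixes \<gamma> :: "real \<Rightarrow> 'a::polish_space"
  assumes p: "1 < p" and \<gamma>: "borel_map_on a b \<gamma>"
  shows "ae_class a b \<gamma> \<in> W1p p a b \<longleftrightarrow> \<gamma> \<in> Lp_map p a b \<and>
    (\<exists>E. E \<in> sets borel \<and> E \<subseteq> {a..b} \<and> emeasure lborel ({a..b} - E) = 0 \<and> Lp_dominated p E \<gamma>)"
    (is "_ \<longleftrightarrow> ?R")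
proof
  assume "ae_class a b \<gamma> \<in> W1p p a b"
  then obtain \<beta> G E where eq: "ae_class a b \<gamma> = ae_class a b \<beta>" and \<beta>: "ae_class a b \<beta> \<in> Lp_space p a b"
    and G: "G \<in> Lp_fun p a b" "\<forall>t\<in>{a..b}. 0 \<le> G t"
    and E: "E \<in> sets borel" "E \<subseteq> {a..b}" "emeasure lborel ({a..b} - E) = 0"
    and dist: "\<forall>t1\<in>E. \<forall>t2\<in>E. t1 \<le> t2 \<longrightarrow> dist (\<beta> t1) (\<beta> t2) \<le> (LINT t:{t1..t2}|lborel. G t)"
    unfolding W1p_def by blast
  obtain f where f: "f \<in> Lp_map p a b" "ae_class a b \<gamma> = ae_class a b f"
    using \<beta> unfolding Lp_space_def eq[symmetric] by blast
  have Lp: "\<gamma> \<in> Lp_map p a b"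
    by (rule Lp_map_cong_AE[OF f(1) \<gamma> ae_class_eq_imp_AE[OF \<gamma> f(2)]])
  have "AE t in lborel. t \<in> {a..b} \<longrightarrow> \<gamma> t = \<beta> t"
    using ae_class_eq_imp_AE[OF \<gamma> eq] by (simp add: AE_interval_iff)
  then obtain N where N: "N \<in> null_sets lborel" "\<And>t. t \<in> space lborel - N \<Longrightarrow> t \<in> {a..b} \<longrightarrow> \<gamma> t = \<beta> t"
    by (rule AE_E3) blast
  have "Lp_dominated p E \<beta>"
    unfolding Lp_dominated_iff_Lp_fun[OF p E(2)] using G dist by blast
  then have "Lp_dominated p (E - N) \<gamma>"
  proof (rule Lp_dominated_cong_subset)
    show "\<gamma> t = \<beta> t" if "t \<in> E - N" for t using N(2)[of t] that E(2) by auto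
  qed blast
  moreover have "emeasure lborel ({a..b} - (E - N)) = 0"
  proof -
    have "{a..b} - (E - N) \<subseteq> ({a..b} - E) \<union> N" by blast
    moreover have "({a..b} - E) \<union> N \<in> null_sets lborel"
      using E N(1) by (intro null_sets.Un) (auto simp: null_sets_def)
    ultimately have "emeasure lborel ({a..b} - (E - N)) \<le> 0"
      using emeasure_mono[of "{a..b} - (E - N)" "({a..b} - E) \<union> N" lborel] by (simp add: null_sets_def)
    then show ?thesis by simp
  qed
  ultimately show ?R using Lp E N(1) by (intro conjI exI[of _ "E - N"]) auto
next
  assume R: ?R
  then obtain E where E: "E \<in> sets borel" "E \<subseteq> {a..b}" "emeasure lborel ({a..b} - E) = 0" "Lp_dominated p E \<gamma>"
    by blast
  have "ae_class a b \<gamma> \<in> Lp_space p a b" using R unfolding Lp_space_def by blast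
  moreover obtain G where "G \<in> Lp_fun p a b" "\<forall>t\<in>{a..b}. 0 \<le> G t"
    "\<forall>t1\<in>E. \<forall>t2\<in>E. t1 \<le> t2 \<longrightarrow> dist (\<gamma> t1) (\<gamma> t2) \<le> (LINT t:{t1..t2}|lborel. G t)"
    using E(4) unfolding Lp_dominated_iff_Lp_fun[OF p E(2)] by blast
  ultimately show "ae_class a b \<gamma> \<in> W1p p a b"
    using \<gamma> E(1-3) unfolding W1p_def by blast
qed

text \<open>
  An open set is the set where the distance to its complement is positive, and this distance is \<open>1\<close>-Lipschitz.
\<close>

lemma borel_measurable_if_lipschitz_compositions:
  fixes f :: "'b \<Rightarrow> 'a::metric_space"
  assumes "\<And>h::'a \<Rightarrow> real. 1-lipschitz_on UNIV h \<Longrightarrow> (\<lambda>t. h (f t)) \<in> borel_measurable M"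
  shows "f \<in> borel_measurable M"
proof (rule borel_measurableI)
  fix S :: "'a set" assume S: "open S"
  show "f -` S \<inter> space M \<in> sets M"
  proof (cases "S = UNIV")
    case False
    let ?h = "\<lambda>x. infdist x (- S)"
    have "1-lipschitz_on UNIV ?h"
      by (intro lipschitz_onI) (use infdist_triangle_abs in \<open>auto simp: dist_real_def\<close>)
    from assms[OF this] have "(\<lambda>t. ?h (f t)) -` {0<..} \<inter> space M \<in> sets M"
      by (rule measurable_sets) simp
    moreover have "0 < ?h x \<longleftrightarrow> x \<in> S" for x
      using in_closed_iff_infdist_zero[of "- S" x] S False infdist_nonneg[of x "- S"]
      by (auto simp: closed_Compl less_le)
    ultimately show ?thesis by (simp add: vimage_def)
  qed simp
qed

lemma Lp_map_lipschitz_comp: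
  fixes \<gamma> :: "real \<Rightarrow> 'a::polish_space" and h :: "'a \<Rightarrow> real"
  assumes p: "0 \<le> p" and \<gamma>: "\<gamma> \<in> Lp_map p a b" and h: "C-lipschitz_on UNIV h"
  shows "(\<lambda>t. h (\<gamma> t)) \<in> Lp_map p a b"
proof -
  obtain y where y: "(\<lambda>t. dist y (\<gamma> t)) \<in> Lp_fun p a b" and \<gamma>m: "borel_map_on a b \<gamma>"
    using \<gamma> unfolding Lp_map_def by blast
  have [measurable]: "h \<in> borel_measurable borel"
    using lipschitz_on_continuous_on[OF h] by (rule borel_measurable_continuous_onI)
  have hm: "borel_map_on a b (\<lambda>t. h (\<gamma> t))" using \<gamma>m by measurable
  have "(\<lambda>t. dist (h y) (h (\<gamma> t))) \<in> Lp_fun p a b"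
  proof (rule Lp_fun_scaled_bound[OF p y _ _ lipschitz_on_nonneg[OF h] order_refl])
    show "borel_map_on a b (\<lambda>t. dist (h y) (h (\<gamma> t)))" using hm by measurable
    show "\<bar>dist (h y) (h (\<gamma> t))\<bar> \<le> 0 + C * \<bar>dist y (\<gamma> t)\<bar>" for t
      using lipschitz_onD[OF h, of y "\<gamma> t"] by simp
  qed
  then show ?thesis using hm unfolding Lp_map_def by blast
qed

lemma Lp_map_if_dist_Lp_map:
  fixes \<gamma> :: "real \<Rightarrow> 'a::polish_space"
  assumes p: "0 \<le> p" and \<gamma>: "borel_map_on a b \<gamma>" and y: "(\<lambda>t. dist y (\<gamma> t)) \<in> Lp_map p a b"
  shows "\<gamma> \<in> Lp_map p a b"
proof -
  obtain r where r: "(\<lambda>t. dist r (dist y (\<gamma> t))) \<in> Lp_fun p a b" using y unfolding Lp_map_def by blast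
  have "(\<lambda>t. dist y (\<gamma> t)) \<in> Lp_fun p a b"
  proof (rule Lp_fun_scaled_bound[OF p r])
    show "borel_map_on a b (\<lambda>t. dist y (\<gamma> t))" using \<gamma> by measurable
    show "\<bar>dist y (\<gamma> t)\<bar> \<le> \<bar>r\<bar> + 1 * \<bar>dist r (dist y (\<gamma> t))\<bar>" for t by (simp add: dist_real_def)
  qed auto
  then show ?thesis using \<gamma> unfolding Lp_map_def by blast
qed

theorem theorem1p4:
  fixes \<gamma> :: "real \<Rightarrow> 'a::polish_space" and a b p :: real
  assumes "a < b" and "1 < p"
  shows "(borel_map_on a b \<gamma> \<and> ae_class a b \<gamma> \<in> W1p p a b) \<longleftrightarrow>
    (\<forall>h :: 'a \<Rightarrow> real. (\<exists>C. C-lipschitz_on UNIV h) \<longrightarrow>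
       borel_map_on a b (h \<circ> \<gamma>) \<and> ae_class a b (h \<circ> \<gamma>) \<in> W1p p a b)"
  (is "?L \<longleftrightarrow> ?R")
proof
  assume L: ?L
  then have \<gamma>: "borel_map_on a b \<gamma>" by blast
  obtain E where \<gamma>Lp: "\<gamma> \<in> Lp_map p a b" and E: "E \<in> sets borel" "E \<subseteq> {a..b}"
    "emeasure lborel ({a..b} - E) = 0" "Lp_dominated p E \<gamma>"
    using L ae_class_in_W1p_iff[OF \<open>1 < p\<close> \<gamma>] by blast
  show ?R
  proof (intro allI impI)
    fix h :: "'a \<Rightarrow> real" assume "\<exists>C. C-lipschitz_on UNIV h"
    then obtain C where h: "C-lipschitz_on UNIV h" by blast
    have Lp: "h \<circ> \<gamma> \<in> Lp_map p a b"
      using Lp_map_lipschitz_comp[OF _ \<gamma>Lp h] \<open>1 < p\<close> by (simp add: comp_def)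
    then have m: "borel_map_on a b (h \<circ> \<gamma>)" unfolding Lp_map_def by blast
    moreover have "Lp_dominated p E (h \<circ> \<gamma>)"
      using Lp_dominated_lipschitz_comp[OF E(4) h] by (simp add: comp_def)
    ultimately show "borel_map_on a b (h \<circ> \<gamma>) \<and> ae_class a b (h \<circ> \<gamma>) \<in> W1p p a b"
      using Lp E(1-3) ae_class_in_W1p_iff[OF \<open>1 < p\<close> m] by blast
  qed
next
  assume R: ?R
  have m: "borel_map_on a b (\<lambda>t. h (\<gamma> t))" and W: "ae_class a b (\<lambda>t. h (\<gamma> t)) \<in> W1p p a b"
    if "\<exists>C. C-lipschitz_on UNIV h" for h :: "'a \<Rightarrow> real"
    using R[rule_format, OF that] by (simp_all add: comp_def)
  have \<gamma>: "borel_map_on a b \<gamma>" 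
    by (rule borel_measurable_if_lipschitz_compositions) (rule m[OF exI])
  fix y :: 'a
  have y: "\<exists>C. C-lipschitz_on UNIV (dist y)" using lipschitz_dist by blast
  have "\<gamma> \<in> Lp_map p a b"
  proof (rule Lp_map_if_dist_Lp_map[OF _ \<gamma>])
    show "(\<lambda>t. dist y (\<gamma> t)) \<in> Lp_map p a b"
      using W[OF y] ae_class_in_W1p_iff[OF \<open>1 < p\<close> m[OF y]] by blast
  qed (use \<open>1 < p\<close> in simp)
  moreover have "\<exists>E. E \<in> sets borel \<and> E \<subseteq> {a..b} \<and> emeasure lborel ({a..b} - E) = 0 \<and> Lp_dominated p E \<gamma>"
  proof (rule Lp_dominated_if_lipschitz_compositions[OF assms])
    fix h :: "'a \<Rightarrow> real" assume h: "\<exists>C. C-lipschitz_on UNIV h"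
    show "\<exists>E. E \<in> sets borel \<and> E \<subseteq> {a..b} \<and> emeasure lborel ({a..b} - E) = 0 \<and> Lp_dominated p E (\<lambda>t. h (\<gamma> t))"
      using W[OF h] ae_class_in_W1p_iff[OF \<open>1 < p\<close> m[OF h]] by blast
  qed
  ultimately show ?L using \<gamma> ae_class_in_W1p_iff[OF \<open>1 < p\<close> \<gamma>] by blast
qed

end
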